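(* Let $\mathcal{C}$ be a cd-category with effect conditioning, and let $\omega\colon I\to X_1\otimes\cdots\otimes X_n$ be a state. For pairwise disjoint subsets $A,B,C\subseteq\{1,\dots,n\}$ write $(A\perp\!\!\!\perp B\mid C)_\omega$ for conditional independence as defined below. Then for all pairwise disjoint subsets $A,B,C,D\subseteq\{1,\dots,n\}$ the following (semi-graphoid axioms) hold: (Symmetry) $(A\perp\!\!\!\perp B\mid C)_\omega \iff (B\perp\!\!\!\perp A\mid C)_\omega$; (Decomposition) $(A\perp\!\!\!\perp B\cup D\mid C)_\omega \implies (A\perp\!\!\!\perp B\mid C)_\omega$ and $(A\perp\!\!\!\perp D\mid C)_\omega$; (Weak union) $(A\perp\!\!\!\perp B\cup D\mid C)_\omega \implies (A\perp\!\!\!\perp B\mid C\cup D)_\omega$; (Contraction) $(A\perp\!\!\!\perp B\mid C\cup D)_\omega$ and $(A\perp\!\!\!\perp D\mid C)_\omega$ together imply $(A\perp\!\!\!\perp B\cup D\mid C)_\omega$.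
   Context: A cd-category is a symmetric monoidal category $(\mathcal{C},\otimes,I)$ (symmetry $\sigma$) in which every object $X$ carries morphisms $\Delta_X\colon X\to X\otimes X$ (copy) and $\epsilon_X\colon X\to I$ (discard) forming a commutative comonoid, compatible with the tensor: $\Delta_{X\otimes Y}=(\mathrm{id}_X\otimes\sigma_{X,Y}\otimes\mathrm{id}_Y)\circ(\Delta_X\otimes\Delta_Y)$, $\epsilon_{X\otimes Y}=\epsilon_X\otimes\epsilon_Y$, $\Delta_I=\mathrm{id}_I$, $\epsilon_I=\mathrm{id}_I$ (up to unit isomorphisms). A state is a morphism $I\to X$, an effect a morphism $X\to I$. A morphism $f\colon X\to Y$ is a partial channel if $f=(f\otimes(\epsilon_Y\circ f))\circ\Delta_X$. Normalisation: an assignment to each morphism $f\colon X\to Y$ of a partial channel $\mathrm{norm}(f)\colon X\to Y$ such that (N0) $f=(\mathrm{norm}(f)\otimes(\epsilon_Y\circ f))\circ\Delta_X$; (N1) $\mathrm{norm}(f)=f$ whenever $f$ is a partial channel; (N2) $\mathrm{norm}(f\otimes g)=\mathrm{norm}(f)\otimes\mathrm{norm}(g)$; (N3) $\mathrm{norm}(\epsilon_Y\circ f)=\epsilon_Y\circ\mathrm{norm}(f)$; (N4) $\mathrm{norm}(f\circ\Delta_X)=\mathrm{norm}(f)\circ\Delta_X$ for every $f\colon X\otimes X\to Y$. Caps: a choice of effect $\cap_X\colon X\otimes X\to I$ for each $X$, with $\cap_X\circ\sigma_{X,X}=\cap_X$, $\cap_X\circ\Delta_X=\epsilon_X$, $(\cap_X\otimes\mathrm{id}_X)\circ(\mathrm{id}_X\otimes\Delta_X)=(\mathrm{id}_X\otimes\cap_X)\circ(\Delta_X\otimes\mathrm{id}_X)$,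 $\cap_{X\otimes Y}=(\cap_X\otimes\cap_Y)\circ(\mathrm{id}_X\otimes\sigma_{Y,X}\otimes\mathrm{id}_Y)$, $\cap_I=\mathrm{id}_I$. Caps are cancellative if for all $f,g\colon A\to B\otimes X$, $(\mathrm{id}_B\otimes\cap_X)\circ(f\otimes\mathrm{id}_X)=(\mathrm{id}_B\otimes\cap_X)\circ(g\otimes\mathrm{id}_X)$ implies $f=g$. $\mathcal{C}$ has effect conditioning if it has normalisation and cancellative caps. Conditional: for $f\colon X\to Y\otimes Z$, $f|_Z:=\mathrm{norm}\big((\mathrm{id}_Y\otimes\cap_Z)\circ(f\otimes\mathrm{id}_Z)\big)\colon X\otimes Z\to Y$; for a state ($X=I$) this is a morphism $Z\to Y$. Notation: for $S\subseteq\{1,\dots,n\}$ let $X_S=\bigotimes_{i\in S}X_i$ ($X_\emptyset=I$) and $\omega_S$ the marginal of $\omega$ on $X_S$ (discard all other factors). For disjoint $S,T$, $\omega_{S|T}\colon X_T\to X_S$ is the conditional $(\omega_{S\cup T})|_{X_T}$, where $\omega_{S\cup T}$ is regarded (via symmetries) as a state of $X_S\otimes X_T$. Conditional independence: $(A\perp\!\!\!\perp B\mid C)_\omega$ iff $\omega_{A\cup B|C}=(\omega_{A|C}\otimes\omega_{B|C})\circ\Delta_{X_C}$ (identifying $X_{A\cup B}\cong X_A\otimes X_B$). *)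

theory Defs
  imports Main
begin

section \<open>Categories\<close>

text \<open>
  A category has a set of objects inside \<open>'o\<close> and a set of arrows inside \<open>'m\<close>; composition is
  only constrained on composable pairs of arrows.
\<close>

record ('o, 'm) cat =
  Obj :: "'o set"
  Arr :: "'m set"
  Dom :: "'m \<Rightarrow> 'o"
  Cod :: "'m \<Rightarrow> 'o"
  Id :: "'o \<Rightarrow> 'm" (\<open>\<i>\<index>\<close>)
  Comp :: "'m \<Rightarrow> 'm \<Rightarrow> 'm" (infixr \<open>\<cdot>\<index>\<close> 55)

definition hom :: "('o, 'm, 'z) cat_scheme \<Rightarrow> 'o \<Rightarrow> 'o \<Rightarrow> 'm set" where
  "hom \<C> X Y = {f \<in> Arr \<C>. Dom \<C> f = X \<and> Cod \<C> f = Y}"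

definition inverse_arrows :: "('o, 'm, 'z) cat_scheme \<Rightarrow> 'm \<Rightarrow> 'm \<Rightarrow> bool" where
  "inverse_arrows \<C> f g \<longleftrightarrow>
     f \<in> Arr \<C> \<and> g \<in> hom \<C> (Cod \<C> f) (Dom \<C> f) \<and>
     Comp \<C> g f = Id \<C> (Dom \<C> f) \<and> Comp \<C> f g = Id \<C> (Cod \<C> f)"

definition iso :: "('o, 'm, 'z) cat_scheme \<Rightarrow> 'm \<Rightarrow> bool" where
  "iso \<C> f \<longleftrightarrow> (\<exists>g. inverse_arrows \<C> f g)"

definition inv_arr :: "('o, 'm, 'z) cat_scheme \<Rightarrow> 'm \<Rightarrow> 'm" where
  "inv_arr \<C> f = (THE g. inverse_arrows \<C> f g)"

locale category =
  fixes \<C> :: "('o, 'm, 'z) cat_scheme" (structure)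
  assumes Dom_Obj: "f \<in> Arr \<C> \<Longrightarrow> Dom \<C> f \<in> Obj \<C>"
    and Cod_Obj: "f \<in> Arr \<C> \<Longrightarrow> Cod \<C> f \<in> Obj \<C>"
    and Id_hom: "X \<in> Obj \<C> \<Longrightarrow> \<i> X \<in> hom \<C> X X"
    and Comp_hom: "\<lbrakk>f \<in> hom \<C> X Y; g \<in> hom \<C> Y Z\<rbrakk> \<Longrightarrow> g \<cdot> f \<in> hom \<C> X Z"
    and Id_left: "f \<in> hom \<C> X Y \<Longrightarrow> \<i> Y \<cdot> f = f"
    and Id_right: "f \<in> hom \<C> X Y \<Longrightarrow> f \<cdot> \<i> X = f"
    and Comp_assoc: "\<lbrakk>f \<in> hom \<C> W X; g \<in> hom \<C> X Y; h \<in> hom \<C> Y Z\<rbrakk>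
      \<Longrightarrow> (h \<cdot> g) \<cdot> f = h \<cdot> (g \<cdot> f)"

section \<open>Symmetric monoidal categories\<close>

text \<open>
  Strictness is not assumed. On objects the tensor is written \<open>\<odot>\<close>, on arrows \<open>\<otimes>\<close>.
  The structural arrows are
  \<open>Assoc X Y Z : (X \<odot> Y) \<odot> Z \<rightarrow> X \<odot> (Y \<odot> Z)\<close>,
  \<open>LUnit X : I \<odot> X \<rightarrow> X\<close>, \<open>RUnit X : X \<odot> I \<rightarrow> X\<close> and
  \<open>Sym X Y : X \<odot> Y \<rightarrow> Y \<odot> X\<close>.
\<close>

record ('o, 'm) smc = "('o, 'm) cat" +
  TensorO :: "'o \<Rightarrow> 'o \<Rightarrow> 'o" (infixr \<open>\<odot>\<index>\<close> 70)
  TensorA :: "'m \<Rightarrow> 'm \<Rightarrow> 'm" (infixr \<open>\<otimes>\<index>\<close> 70)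
  Unit :: "'o" (\<open>\<I>\<index>\<close>)
  Assoc :: "'o \<Rightarrow> 'o \<Rightarrow> 'o \<Rightarrow> 'm" (\<open>\<alpha>\<index>\<close>)
  LUnit :: "'o \<Rightarrow> 'm" (\<open>\<lambda>\<^sub>u\<index>\<close>)
  RUnit :: "'o \<Rightarrow> 'm" (\<open>\<rho>\<^sub>u\<index>\<close>)
  Sym :: "'o \<Rightarrow> 'o \<Rightarrow> 'm" (\<open>\<sigma>\<index>\<close>)

abbreviation Assoc_inv :: "('o, 'm, 'z) smc_scheme \<Rightarrow> 'o \<Rightarrow> 'o \<Rightarrow> 'o \<Rightarrow> 'm" (\<open>\<alpha>''\<index>\<close>) where
  "Assoc_inv \<C> X Y Z \<equiv> inv_arr \<C> (Assoc \<C> X Y Z)"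

locale symmetric_monoidal_category = category \<C>
  for \<C> :: "('o, 'm, 'z) smc_scheme" (structure) +
  assumes TensorO_Obj: "\<lbrakk>X \<in> Obj \<C>; Y \<in> Obj \<C>\<rbrakk> \<Longrightarrow> X \<odot> Y \<in> Obj \<C>"
    and Unit_Obj: "\<I> \<in> Obj \<C>"
    and TensorA_hom: "\<lbrakk>f \<in> hom \<C> X Y; g \<in> hom \<C> X' Y'\<rbrakk>
      \<Longrightarrow> f \<otimes> g \<in> hom \<C> (X \<odot> X') (Y \<odot> Y')"
    and TensorA_Id: "\<lbrakk>X \<in> Obj \<C>; Y \<in> Obj \<C>\<rbrakk> \<Longrightarrow> \<i> X \<otimes> \<i> Y = \<i> (X \<odot> Y)"
    and TensorA_Comp: "\<lbrakk>f \<in> hom \<C> X Y; g \<in> hom \<C> Y Z; f' \<in> hom \<C> X' Y'; g' \<in> hom \<C> Y' Z'\<rbrakk>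
      \<Longrightarrow> (g \<cdot> f) \<otimes> (g' \<cdot> f') = (g \<otimes> g') \<cdot> (f \<otimes> f')"
    and Assoc_hom: "\<lbrakk>X \<in> Obj \<C>; Y \<in> Obj \<C>; Z \<in> Obj \<C>\<rbrakk>
      \<Longrightarrow> \<alpha> X Y Z \<in> hom \<C> ((X \<odot> Y) \<odot> Z) (X \<odot> (Y \<odot> Z))"
    and Assoc_iso: "\<lbrakk>X \<in> Obj \<C>; Y \<in> Obj \<C>; Z \<in> Obj \<C>\<rbrakk> \<Longrightarrow> iso \<C> (\<alpha> X Y Z)"
    and Assoc_natural: "\<lbrakk>f \<in> hom \<C> X X'; g \<in> hom \<C> Y Y'; h \<in> hom \<C> Z Z'\<rbrakk>
      \<Longrightarrow> \<alpha> X' Y' Z' \<cdot> ((f \<otimes> g) \<otimes> h) = (f \<otimes> (g \<otimes> h)) \<cdot> \<alpha> X Y Z"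
    and LUnit_hom: "X \<in> Obj \<C> \<Longrightarrow> \<lambda>\<^sub>u X \<in> hom \<C> (\<I> \<odot> X) X"
    and LUnit_iso: "X \<in> Obj \<C> \<Longrightarrow> iso \<C> (\<lambda>\<^sub>u X)"
    and LUnit_natural: "f \<in> hom \<C> X Y \<Longrightarrow> \<lambda>\<^sub>u Y \<cdot> (\<i> \<I> \<otimes> f) = f \<cdot> \<lambda>\<^sub>u X"
    and RUnit_hom: "X \<in> Obj \<C> \<Longrightarrow> \<rho>\<^sub>u X \<in> hom \<C> (X \<odot> \<I>) X"
    and RUnit_iso: "X \<in> Obj \<C> \<Longrightarrow> iso \<C> (\<rho>\<^sub>u X)"
    and RUnit_natural: "f \<in> hom \<C> X Y \<Longrightarrow> \<rho>\<^sub>u Y \<cdot> (f \<otimes> \<i> \<I>) = f \<cdot> \<rho>\<^sub>u X"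
    and pentagon: "\<lbrakk>W \<in> Obj \<C>; X \<in> Obj \<C>; Y \<in> Obj \<C>; Z \<in> Obj \<C>\<rbrakk>
      \<Longrightarrow> (\<i> W \<otimes> \<alpha> X Y Z) \<cdot> \<alpha> W (X \<odot> Y) Z \<cdot> (\<alpha> W X Y \<otimes> \<i> Z)
          = \<alpha> W X (Y \<odot> Z) \<cdot> \<alpha> (W \<odot> X) Y Z"
    and triangle: "\<lbrakk>X \<in> Obj \<C>; Y \<in> Obj \<C>\<rbrakk>
      \<Longrightarrow> (\<i> X \<otimes> \<lambda>\<^sub>u Y) \<cdot> \<alpha> X \<I> Y = \<rho>\<^sub>u X \<otimes> \<i> Y"
    and Sym_hom: "\<lbrakk>X \<in> Obj \<C>; Y \<in> Obj \<C>\<rbrakk> \<Longrightarrow> \<sigma> X Y \<in> hom \<C> (X \<odot> Y) (Y \<odot> X)"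
    and Sym_natural: "\<lbrakk>f \<in> hom \<C> X X'; g \<in> hom \<C> Y Y'\<rbrakk>
      \<Longrightarrow> \<sigma> X' Y' \<cdot> (f \<otimes> g) = (g \<otimes> f) \<cdot> \<sigma> X Y"
    and Sym_Sym: "\<lbrakk>X \<in> Obj \<C>; Y \<in> Obj \<C>\<rbrakk> \<Longrightarrow> \<sigma> Y X \<cdot> \<sigma> X Y = \<i> (X \<odot> Y)"
    and hexagon: "\<lbrakk>X \<in> Obj \<C>; Y \<in> Obj \<C>; Z \<in> Obj \<C>\<rbrakk>
      \<Longrightarrow> \<alpha> Y Z X \<cdot> \<sigma> X (Y \<odot> Z) \<cdot> \<alpha> X Y Z
          = (\<i> Y \<otimes> \<sigma> X Z) \<cdot> \<alpha> Y X Z \<cdot> (\<sigma> X Y \<otimes> \<i> Z)"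

text \<open>
  The arrow \<open>id \<otimes> \<sigma> \<otimes> id : (W \<odot> X) \<odot> (Y \<odot> Z) \<rightarrow> (W \<odot> Y) \<odot> (X \<odot> Z)\<close>, with its rebracketings.
\<close>

definition mid_swap :: "('o, 'm, 'z) smc_scheme \<Rightarrow> 'o \<Rightarrow> 'o \<Rightarrow> 'o \<Rightarrow> 'o \<Rightarrow> 'm" (\<open>\<mu>\<index>\<close>) where
  "mid_swap \<C> W X Y Z =
     \<alpha>'\<^bsub>\<C>\<^esub> W Y (X \<odot>\<^bsub>\<C>\<^esub> Z) \<cdot>\<^bsub>\<C>\<^esub>
     (\<i>\<^bsub>\<C>\<^esub> W \<otimes>\<^bsub>\<C>\<^esub> (\<alpha>\<^bsub>\<C>\<^esub> Y X Z \<cdot>\<^bsub>\<C>\<^esub> (\<sigma>\<^bsub>\<C>\<^esub> X Y \<otimes>\<^bsub>\<C>\<^esub> \<i>\<^bsub>\<C>\<^esub> Z) \<cdot>\<^bsub>\<C>\<^esub> \<alpha>'\<^bsub>\<C>\<^esub> X Y Z)) \<cdot>\<^bsub>\<C>\<^esub>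
     \<alpha>\<^bsub>\<C>\<^esub> W X (Y \<odot>\<^bsub>\<C>\<^esub> Z)"

section \<open>cd-categories\<close>

record ('o, 'm) cdc = "('o, 'm) smc" +
  Copy :: "'o \<Rightarrow> 'm" (\<open>\<Delta>\<index>\<close>)
  Discard :: "'o \<Rightarrow> 'm" (\<open>\<epsilon>\<index>\<close>)

locale cd_category = symmetric_monoidal_category \<C>
  for \<C> :: "('o, 'm, 'z) cdc_scheme" (structure) +
  assumes Copy_hom: "X \<in> Obj \<C> \<Longrightarrow> \<Delta> X \<in> hom \<C> X (X \<odot> X)"
    and Discard_hom: "X \<in> Obj \<C> \<Longrightarrow> \<epsilon> X \<in> hom \<C> X \<I>"
    and Copy_coassoc: "X \<in> Obj \<C>
      \<Longrightarrow> \<alpha> X X X \<cdot> (\<Delta> X \<otimes> \<i> X) \<cdot> \<Delta> X = (\<i> X \<otimes> \<Delta> X) \<cdot> \<Delta> X"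
    and Copy_counit_left: "X \<in> Obj \<C> \<Longrightarrow> \<lambda>\<^sub>u X \<cdot> (\<epsilon> X \<otimes> \<i> X) \<cdot> \<Delta> X = \<i> X"
    and Copy_counit_right: "X \<in> Obj \<C> \<Longrightarrow> \<rho>\<^sub>u X \<cdot> (\<i> X \<otimes> \<epsilon> X) \<cdot> \<Delta> X = \<i> X"
    and Copy_commute: "X \<in> Obj \<C> \<Longrightarrow> \<sigma> X X \<cdot> \<Delta> X = \<Delta> X"
    and Copy_Tensor: "\<lbrakk>X \<in> Obj \<C>; Y \<in> Obj \<C>\<rbrakk> \<Longrightarrow> \<Delta> (X \<odot> Y) = \<mu> X X Y Y \<cdot> (\<Delta> X \<otimes> \<Delta> Y)"
    and Discard_Tensor: "\<lbrakk>X \<in> Obj \<C>; Y \<in> Obj \<C>\<rbrakk> \<Longrightarrow> \<epsilon> (X \<odot> Y) = \<lambda>\<^sub>u \<I> \<cdot> (\<epsilon> X \<otimes> \<epsilon> Y)"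
    and Copy_Unit: "\<Delta> \<I> = inv_arr \<C> (\<lambda>\<^sub>u \<I>)"
    and Discard_Unit: "\<epsilon> \<I> = \<i> \<I>"

definition partial_channel :: "('o, 'm, 'z) cdc_scheme \<Rightarrow> 'm \<Rightarrow> bool" where
  "partial_channel \<C> f \<longleftrightarrow> f \<in> Arr \<C> \<and>
     f = \<rho>\<^sub>u\<^bsub>\<C>\<^esub> (Cod \<C> f) \<cdot>\<^bsub>\<C>\<^esub> (f \<otimes>\<^bsub>\<C>\<^esub> (\<epsilon>\<^bsub>\<C>\<^esub> (Cod \<C> f) \<cdot>\<^bsub>\<C>\<^esub> f)) \<cdot>\<^bsub>\<C>\<^esub> \<Delta>\<^bsub>\<C>\<^esub> (Dom \<C> f)"

section \<open>Effect conditioning\<close>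

record ('o, 'm) ecc = "('o, 'm) cdc" +
  Norm :: "'m \<Rightarrow> 'm"
  Cap :: "'o \<Rightarrow> 'm"  (\<open>\<kappa>\<index>\<close>)

locale normalisation = cd_category \<C>
  for \<C> :: "('o, 'm, 'z) ecc_scheme" (structure) +
  assumes Norm_hom: "f \<in> hom \<C> X Y \<Longrightarrow> Norm \<C> f \<in> hom \<C> X Y"
    and Norm_partial_channel: "f \<in> Arr \<C> \<Longrightarrow> partial_channel \<C> (Norm \<C> f)"
    and N0: "f \<in> hom \<C> X Y \<Longrightarrow> f = \<rho>\<^sub>u Y \<cdot> (Norm \<C> f \<otimes> (\<epsilon> Y \<cdot> f)) \<cdot> \<Delta> X"
    and N1: "partial_channel \<C> f \<Longrightarrow> Norm \<C> f = f"
    and N2: "\<lbrakk>f \<in> Arr \<C>; g \<in> Arr \<C>\<rbrakk> \<Longrightarrow> Norm \<C> (f \<otimes> g) = Norm \<C> f \<otimes> Norm \<C> g"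
    and N3: "f \<in> hom \<C> X Y \<Longrightarrow> Norm \<C> (\<epsilon> Y \<cdot> f) = \<epsilon> Y \<cdot> Norm \<C> f"
    and N4: "\<lbrakk>X \<in> Obj \<C>; f \<in> hom \<C> (X \<odot> X) Y\<rbrakk> \<Longrightarrow> Norm \<C> (f \<cdot> \<Delta> X) = Norm \<C> f \<cdot> \<Delta> X"

text \<open>
  For \<open>f : A \<rightarrow> B \<odot> X\<close>, the arrow \<open>(id \<otimes> cap) \<circ> (f \<otimes> id) : A \<odot> X \<rightarrow> B\<close>.
\<close>

definition cap_with :: "('o, 'm, 'z) ecc_scheme \<Rightarrow> 'o \<Rightarrow> 'o \<Rightarrow> 'm \<Rightarrow> 'm" where
  "cap_with \<C> B X f =
     \<rho>\<^sub>u\<^bsub>\<C>\<^esub> B \<cdot>\<^bsub>\<C>\<^esub> (\<i>\<^bsub>\<C>\<^esub> B \<otimes>\<^bsub>\<C>\<^esub> \<kappa>\<^bsub>\<C>\<^esub> X) \<cdot>\<^bsub>\<C>\<^esub> \<alpha>\<^bsub>\<C>\<^esub> B X X \<cdot>\<^bsub>\<C>\<^esub> (f \<otimes>\<^bsub>\<C>\<^esub> \<i>\<^bsub>\<C>\<^esub> X)"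

locale caps = cd_category \<C>
  for \<C> :: "('o, 'm, 'z) ecc_scheme" (structure) +
  assumes Cap_hom: "X \<in> Obj \<C> \<Longrightarrow> \<kappa> X \<in> hom \<C> (X \<odot> X) \<I>"
    and Cap_Sym: "X \<in> Obj \<C> \<Longrightarrow> \<kappa> X \<cdot> \<sigma> X X = \<kappa> X"
    and Cap_Copy: "X \<in> Obj \<C> \<Longrightarrow> \<kappa> X \<cdot> \<Delta> X = \<epsilon> X"
    and Cap_Copy_slide: "X \<in> Obj \<C>
      \<Longrightarrow> \<lambda>\<^sub>u X \<cdot> (\<kappa> X \<otimes> \<i> X) \<cdot> \<alpha>' X X X \<cdot> (\<i> X \<otimes> \<Delta> X)
          = \<rho>\<^sub>u X \<cdot> (\<i> X \<otimes> \<kappa> X) \<cdot> \<alpha> X X X \<cdot> (\<Delta> X \<otimes> \<i> X)"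
    and Cap_Tensor: "\<lbrakk>X \<in> Obj \<C>; Y \<in> Obj \<C>\<rbrakk>
      \<Longrightarrow> \<kappa> (X \<odot> Y) = \<lambda>\<^sub>u \<I> \<cdot> (\<kappa> X \<otimes> \<kappa> Y) \<cdot> \<mu> X Y X Y"
    and Cap_Unit: "\<kappa> \<I> = \<lambda>\<^sub>u \<I>"

locale cancellative_caps = caps \<C>
  for \<C> :: "('o, 'm, 'z) ecc_scheme" (structure) +
  assumes Cap_cancel: "\<lbrakk>X \<in> Obj \<C>; B \<in> Obj \<C>; f \<in> hom \<C> A (B \<odot> X); g \<in> hom \<C> A (B \<odot> X);
      cap_with \<C> B X f = cap_with \<C> B X g\<rbrakk> \<Longrightarrow> f = g"

locale effect_conditioning = normalisation \<C> + cancellative_caps \<C>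
  for \<C> :: "('o, 'm, 'z) ecc_scheme" (structure)

text \<open>For \<open>f : X \<rightarrow> Y \<odot> Z\<close>, the conditional \<open>X \<odot> Z \<rightarrow> Y\<close>.\<close>

definition conditional :: "('o, 'm, 'z) ecc_scheme \<Rightarrow> 'o \<Rightarrow> 'o \<Rightarrow> 'm \<Rightarrow> 'm" where
  "conditional \<C> Y Z f = Norm \<C> (cap_with \<C> Y Z f)"

text \<open>For a state \<open>f : I \<rightarrow> Y \<odot> Z\<close>, the conditional read as an arrow \<open>Z \<rightarrow> Y\<close>.\<close>

definition state_conditional :: "('o, 'm, 'z) ecc_scheme \<Rightarrow> 'o \<Rightarrow> 'o \<Rightarrow> 'm \<Rightarrow> 'm" where
  "state_conditional \<C> Y Z f = conditional \<C> Y Z f \<cdot>\<^bsub>\<C>\<^esub> inv_arr \<C> (\<lambda>\<^sub>u\<^bsub>\<C>\<^esub> Z)"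

section \<open>Indexed tensor products, marginals and conditional independence\<close>

text \<open>
  Factors are tensored in increasing order of their index and bracketed to the right. The empty
  product is the unit, and a product with one factor is that factor (not its tensor with the unit).
\<close>

fun tensor_list :: "('o, 'm, 'z) smc_scheme \<Rightarrow> (nat \<Rightarrow> 'o) \<Rightarrow> nat list \<Rightarrow> 'o" where
  "tensor_list \<C> X [] = \<I>\<^bsub>\<C>\<^esub>"
| "tensor_list \<C> X [i] = X i"
| "tensor_list \<C> X (i # j # js) = X i \<odot>\<^bsub>\<C>\<^esub> tensor_list \<C> X (j # js)"

definition tensor_set :: "('o, 'm, 'z) smc_scheme \<Rightarrow> (nat \<Rightarrow> 'o) \<Rightarrow> nat set \<Rightarrow> 'o" where
  "tensor_set \<C> X S = tensor_list \<C> X (sorted_list_of_set S)"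

text \<open>\<open>tensor_cons \<C> X i js : X i \<odot> tensor_list \<C> X js \<rightarrow> tensor_list \<C> X (i # js)\<close>\<close>

definition tensor_cons :: "('o, 'm, 'z) smc_scheme \<Rightarrow> (nat \<Rightarrow> 'o) \<Rightarrow> nat \<Rightarrow> nat list \<Rightarrow> 'm" where
  "tensor_cons \<C> X i js =
     (if js = [] then \<rho>\<^sub>u\<^bsub>\<C>\<^esub> (X i) else \<i>\<^bsub>\<C>\<^esub> (X i \<odot>\<^bsub>\<C>\<^esub> tensor_list \<C> X js))"

text \<open>
  The canonical symmetry
  \<open>tensor_list \<C> X is \<rightarrow> tensor_list \<C> X (filter P is) \<odot> tensor_list \<C> X (filter (\<lambda>j. \<not> P j) is)\<close>
  which moves the factors satisfying \<open>P\<close> to the left and keeps the order otherwise.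
\<close>

fun unshuffle ::
  "('o, 'm, 'z) smc_scheme \<Rightarrow> (nat \<Rightarrow> 'o) \<Rightarrow> (nat \<Rightarrow> bool) \<Rightarrow> nat list \<Rightarrow> 'm" where
  "unshuffle \<C> X P [] = inv_arr \<C> (\<lambda>\<^sub>u\<^bsub>\<C>\<^esub> \<I>\<^bsub>\<C>\<^esub>)"
| "unshuffle \<C> X P (i # is) =
     (let ls = filter P is; rs = filter (\<lambda>j. \<not> P j) is;
          L = tensor_list \<C> X ls; R = tensor_list \<C> X rs;
          step = (\<i>\<^bsub>\<C>\<^esub> (X i) \<otimes>\<^bsub>\<C>\<^esub> unshuffle \<C> X P is) \<cdot>\<^bsub>\<C>\<^esub> inv_arr \<C> (tensor_cons \<C> X i is)
      in if P i
         then (tensor_cons \<C> X i ls \<otimes>\<^bsub>\<C>\<^esub> \<i>\<^bsub>\<C>\<^esub> R) \<cdot>\<^bsub>\<C>\<^esub> \<alpha>'\<^bsub>\<C>\<^esub> (X i) L R \<cdot>\<^bsub>\<C>\<^esub> step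
         else (\<i>\<^bsub>\<C>\<^esub> L \<otimes>\<^bsub>\<C>\<^esub> tensor_cons \<C> X i rs) \<cdot>\<^bsub>\<C>\<^esub> \<alpha>\<^bsub>\<C>\<^esub> L (X i) R \<cdot>\<^bsub>\<C>\<^esub>
              (\<sigma>\<^bsub>\<C>\<^esub> (X i) L \<otimes>\<^bsub>\<C>\<^esub> \<i>\<^bsub>\<C>\<^esub> R) \<cdot>\<^bsub>\<C>\<^esub> \<alpha>'\<^bsub>\<C>\<^esub> (X i) L R \<cdot>\<^bsub>\<C>\<^esub> step)"

text \<open>For disjoint \<open>S\<close> and \<open>T\<close>, the canonical symmetry from the product over \<open>S \<union> T\<close> to the
  tensor of the products over \<open>S\<close> and over \<open>T\<close>.\<close>

definition split_set ::
  "('o, 'm, 'z) smc_scheme \<Rightarrow> (nat \<Rightarrow> 'o) \<Rightarrow> nat set \<Rightarrow> nat set \<Rightarrow> 'm" where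
  "split_set \<C> X S T = unshuffle \<C> X (\<lambda>i. i \<in> S) (sorted_list_of_set (S \<union> T))"

definition marginal ::
  "('o, 'm, 'z) cdc_scheme \<Rightarrow> (nat \<Rightarrow> 'o) \<Rightarrow> nat \<Rightarrow> 'm \<Rightarrow> nat set \<Rightarrow> 'm" where
  "marginal \<C> X n \<omega> S =
     \<rho>\<^sub>u\<^bsub>\<C>\<^esub> (tensor_set \<C> X S) \<cdot>\<^bsub>\<C>\<^esub>
     (\<i>\<^bsub>\<C>\<^esub> (tensor_set \<C> X S) \<otimes>\<^bsub>\<C>\<^esub> \<epsilon>\<^bsub>\<C>\<^esub> (tensor_set \<C> X ({1..n} - S))) \<cdot>\<^bsub>\<C>\<^esub>
     split_set \<C> X S ({1..n} - S) \<cdot>\<^bsub>\<C>\<^esub> \<omega>"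

text \<open>The conditional of \<open>\<omega>\<close> on \<open>S\<close> given \<open>T\<close>, an arrow from the product over \<open>T\<close> to the product
  over \<open>S\<close>.\<close>

definition cond_on ::
  "('o, 'm, 'z) ecc_scheme \<Rightarrow> (nat \<Rightarrow> 'o) \<Rightarrow> nat \<Rightarrow> 'm \<Rightarrow> nat set \<Rightarrow> nat set \<Rightarrow> 'm" where
  "cond_on \<C> X n \<omega> S T =
     state_conditional \<C> (tensor_set \<C> X S) (tensor_set \<C> X T)
       (split_set \<C> X S T \<cdot>\<^bsub>\<C>\<^esub> marginal \<C> X n \<omega> (S \<union> T))"

definition cond_indep ::
  "('o, 'm, 'z) ecc_scheme \<Rightarrow> (nat \<Rightarrow> 'o) \<Rightarrow> nat \<Rightarrow> 'm \<Rightarrow> nat set \<Rightarrow> nat set \<Rightarrow> nat set \<Rightarrow> bool" where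
  "cond_indep \<C> X n \<omega> A B S \<longleftrightarrow>
     split_set \<C> X A B \<cdot>\<^bsub>\<C>\<^esub> cond_on \<C> X n \<omega> (A \<union> B) S
     = (cond_on \<C> X n \<omega> A S \<otimes>\<^bsub>\<C>\<^esub> cond_on \<C> X n \<omega> B S) \<cdot>\<^bsub>\<C>\<^esub> \<Delta>\<^bsub>\<C>\<^esub> (tensor_set \<C> X S)"

end

theory Submission
  imports Defs
begin

text \<open>
  Deterministic arrows, i.e. comonoid homomorphisms, into a tensor product are determined by their
  two projections. All structural arrows are deterministic, so coherence questions reduce to
  comparing projections, and the canonical symmetries \<open>split_set\<close> become pairs of restrictions.

  The axioms on a cap determine it uniquely, so caps are invariant under deterministic isomorphisms.
  Bending outputs into inputs with caps turns every arrow into an effect, faithfully by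
  cancellativity, and effects on a fixed object form a commutative monoid under pointwise
  multiplication. All unnormalised conditionals of a marginal \<open>\<omega>\<^sub>S\<close> turn into one and the same effect
  \<open>w\<^sub>S\<close>, and conditional independence of \<open>A\<close> and \<open>B\<close> given \<open>C\<close> becomes the existence of a partial
  channel \<open>p : X\<^sub>C \<rightarrow> X\<^sub>A\<close> with \<open>w\<^bsub>ABC\<^esub>(a,b,c) = p(a|c) w\<^bsub>BC\<^esub>(b,c)\<close>. Weak union is then immediate, and
  contraction is the computation
  \<open>w\<^bsub>ABCD\<^esub> = \<omega>(a|cd) w\<^bsub>BCD\<^esub> = \<omega>(a|cd) \<omega>(b|cd) w\<^bsub>CD\<^esub> = \<omega>(b|cd) w\<^bsub>ACD\<^esub> = \<omega>(b|cd) p(a|c) w\<^bsub>CD\<^esub> = p(a|c) w\<^bsub>BCD\<^esub>\<close>.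
\<close>

section \<open>Categories and symmetric monoidal categories\<close>

context category
begin

lemma homD: "f \<in> hom \<C> X Y \<Longrightarrow> f \<in> Arr \<C>" "f \<in> hom \<C> X Y \<Longrightarrow> Dom \<C> f = X"
  "f \<in> hom \<C> X Y \<Longrightarrow> Cod \<C> f = Y"
  by (simp_all add: hom_def)

declare Dom_Obj [simp] Cod_Obj [simp]

lemma Id_Arr [simp]: "X \<in> Obj \<C> \<Longrightarrow> \<i> X \<in> Arr \<C>" "X \<in> Obj \<C> \<Longrightarrow> Dom \<C> (\<i> X) = X"
  "X \<in> Obj \<C> \<Longrightarrow> Cod \<C> (\<i> X) = X"
  using Id_hom homD by blast+

lemma Comp_Arr [simp]:
  assumes "f \<in> Arr \<C>" "g \<in> Arr \<C>" "Dom \<C> g = Cod \<C> f"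
  shows "g \<cdot> f \<in> Arr \<C>" "Dom \<C> (g \<cdot> f) = Dom \<C> f" "Cod \<C> (g \<cdot> f) = Cod \<C> g"
  using Comp_hom [of f "Dom \<C> f" "Cod \<C> f" g "Cod \<C> g"] assms by (simp_all add: hom_def)

lemma Comp_Id [simp]:
  "\<lbrakk>f \<in> Arr \<C>; Cod \<C> f = Y\<rbrakk> \<Longrightarrow> \<i> Y \<cdot> f = f" "\<lbrakk>f \<in> Arr \<C>; Dom \<C> f = X\<rbrakk> \<Longrightarrow> f \<cdot> \<i> X = f"
  using Id_left Id_right by (auto simp: hom_def)

lemma Comp_assoc' [simp]:
  "\<lbrakk>f \<in> Arr \<C>; g \<in> Arr \<C>; h \<in> Arr \<C>; Dom \<C> g = Cod \<C> f; Dom \<C> h = Cod \<C> g\<rbrakk>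
    \<Longrightarrow> (h \<cdot> g) \<cdot> f = h \<cdot> (g \<cdot> f)"
  using Comp_assoc by (simp add: hom_def)

lemma Comp_cong_right:
  "\<lbrakk>g \<cdot> f = k; f \<in> Arr \<C>; g \<in> Arr \<C>; h \<in> Arr \<C>; Dom \<C> g = Cod \<C> f; Dom \<C> f = Cod \<C> h\<rbrakk>
    \<Longrightarrow> g \<cdot> (f \<cdot> h) = k \<cdot> h"
  using Comp_assoc' [of h f g] by simp

lemma inv_arr_unique:
  assumes "inverse_arrows \<C> f g" "inverse_arrows \<C> f h"
  shows "g = h"
proof -
  have "h \<cdot> f = \<i> (Cod \<C> g)" "g \<in> Arr \<C>"
    using assms by (auto simp: inverse_arrows_def hom_def)
  then have "g = (h \<cdot> f) \<cdot> g"
    by simp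
  also have "\<dots> = h \<cdot> (f \<cdot> g)"
    using assms by (intro Comp_assoc') (auto simp: inverse_arrows_def hom_def)
  also have "\<dots> = h"
    using assms by (simp add: inverse_arrows_def hom_def)
  finally show ?thesis .
qed

lemma inv_arr_eqI: "inverse_arrows \<C> f g \<Longrightarrow> inv_arr \<C> f = g"
  unfolding inv_arr_def using inv_arr_unique by blast

lemma inverse_arrows_inv_arr: "iso \<C> f \<Longrightarrow> inverse_arrows \<C> f (inv_arr \<C> f)"
  using inv_arr_eqI by (auto simp: iso_def)

lemma iso_inv_arr [simp]:
  assumes "iso \<C> f"
  shows "inv_arr \<C> f \<in> Arr \<C>" "Dom \<C> (inv_arr \<C> f) = Cod \<C> f" "Cod \<C> (inv_arr \<C> f) = Dom \<C> f"
    "inv_arr \<C> f \<cdot> f = \<i> (Dom \<C> f)" "f \<cdot> inv_arr \<C> f = \<i> (Cod \<C> f)"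
  using inverse_arrows_inv_arr [OF assms] by (simp_all add: inverse_arrows_def hom_def)

lemma iso_Arr: "iso \<C> f \<Longrightarrow> f \<in> Arr \<C>"
  by (auto simp: iso_def inverse_arrows_def)

lemma inv_arr_eqI_right:
  assumes "iso \<C> f" "g \<in> Arr \<C>" "Dom \<C> f = Cod \<C> g" "f \<cdot> g = \<i> (Cod \<C> f)"
  shows "inv_arr \<C> f = g"
proof -
  have "Dom \<C> g = Cod \<C> f"
    using arg_cong [OF assms(4), of "Dom \<C>"] Comp_Arr(2) [OF assms(2) iso_Arr [OF assms(1)] assms(3)]
      iso_Arr [OF assms(1)] by simp
  have "(inv_arr \<C> f \<cdot> f) \<cdot> g = inv_arr \<C> f"
    using assms iso_Arr [OF assms(1)] by (subst Comp_assoc') auto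
  then show ?thesis
    using assms by simp
qed

end

section \<open>Typing and naturality of the structural arrows\<close>

context symmetric_monoidal_category
begin

declare TensorO_Obj [simp] Unit_Obj [simp] TensorA_Id [simp] Assoc_iso [simp] LUnit_iso [simp]
  RUnit_iso [simp]

lemma TensorA_Arr [simp]:
  assumes "f \<in> Arr \<C>" "g \<in> Arr \<C>"
  shows "f \<otimes> g \<in> Arr \<C>" "Dom \<C> (f \<otimes> g) = Dom \<C> f \<odot> Dom \<C> g" "Cod \<C> (f \<otimes> g) = Cod \<C> f \<odot> Cod \<C> g"
  using TensorA_hom [of f "Dom \<C> f" "Cod \<C> f" g "Dom \<C> g" "Cod \<C> g"] assms by (simp_all add: hom_def)

lemma TensorA_Comp' [simp]:
  "\<lbrakk>f \<in> Arr \<C>; g \<in> Arr \<C>; f' \<in> Arr \<C>; g' \<in> Arr \<C>; Dom \<C> g = Cod \<C> f; Dom \<C> g' = Cod \<C> f'\<rbrakk>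
    \<Longrightarrow> (g \<otimes> g') \<cdot> (f \<otimes> f') = (g \<cdot> f) \<otimes> (g' \<cdot> f')"
  using TensorA_Comp by (simp add: hom_def)

lemma TensorA_Comp_left [simp]:
  "\<lbrakk>f \<in> Arr \<C>; g \<in> Arr \<C>; f' \<in> Arr \<C>; g' \<in> Arr \<C>; h \<in> Arr \<C>; Dom \<C> g = Cod \<C> f; Dom \<C> g' = Cod \<C> f';
      Dom \<C> f \<odot> Dom \<C> f' = Cod \<C> h\<rbrakk>
    \<Longrightarrow> (g \<otimes> g') \<cdot> ((f \<otimes> f') \<cdot> h) = ((g \<cdot> f) \<otimes> (g' \<cdot> f')) \<cdot> h"
  by (rule Comp_cong_right) simp_all

lemma structural_Arr [simp]:
  "\<lbrakk>X \<in> Obj \<C>; Y \<in> Obj \<C>; Z \<in> Obj \<C>\<rbrakk> \<Longrightarrow> \<alpha> X Y Z \<in> Arr \<C>"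
  "\<lbrakk>X \<in> Obj \<C>; Y \<in> Obj \<C>; Z \<in> Obj \<C>\<rbrakk> \<Longrightarrow> Dom \<C> (\<alpha> X Y Z) = (X \<odot> Y) \<odot> Z"
  "\<lbrakk>X \<in> Obj \<C>; Y \<in> Obj \<C>; Z \<in> Obj \<C>\<rbrakk> \<Longrightarrow> Cod \<C> (\<alpha> X Y Z) = X \<odot> (Y \<odot> Z)"
  "X \<in> Obj \<C> \<Longrightarrow> \<lambda>\<^sub>u X \<in> Arr \<C>" "X \<in> Obj \<C> \<Longrightarrow> Dom \<C> (\<lambda>\<^sub>u X) = \<I> \<odot> X" "X \<in> Obj \<C> \<Longrightarrow> Cod \<C> (\<lambda>\<^sub>u X) = X"
  "X \<in> Obj \<C> \<Longrightarrow> \<rho>\<^sub>u X \<in> Arr \<C>" "X \<in> Obj \<C> \<Longrightarrow> Dom \<C> (\<rho>\<^sub>u X) = X \<odot> \<I>" "X \<in> Obj \<C> \<Longrightarrow> Cod \<C> (\<rho>\<^sub>u X) = X"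
  "\<lbrakk>X \<in> Obj \<C>; Y \<in> Obj \<C>\<rbrakk> \<Longrightarrow> \<sigma> X Y \<in> Arr \<C>" "\<lbrakk>X \<in> Obj \<C>; Y \<in> Obj \<C>\<rbrakk> \<Longrightarrow> Dom \<C> (\<sigma> X Y) = X \<odot> Y"
  "\<lbrakk>X \<in> Obj \<C>; Y \<in> Obj \<C>\<rbrakk> \<Longrightarrow> Cod \<C> (\<sigma> X Y) = Y \<odot> X"
  using Assoc_hom LUnit_hom RUnit_hom Sym_hom by (simp_all add: hom_def)

lemma Assoc_nat:
  "\<lbrakk>f \<in> Arr \<C>; g \<in> Arr \<C>; h \<in> Arr \<C>; Cod \<C> f = X; Cod \<C> g = Y; Cod \<C> h = Z\<rbrakk>
    \<Longrightarrow> \<alpha> X Y Z \<cdot> ((f \<otimes> g) \<otimes> h) = (f \<otimes> (g \<otimes> h)) \<cdot> \<alpha> (Dom \<C> f) (Dom \<C> g) (Dom \<C> h)"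
  by (rule Assoc_natural) (simp_all add: hom_def)

lemma Assoc_inv_nat:
  assumes "f \<in> Arr \<C>" "g \<in> Arr \<C>" "h \<in> Arr \<C>" "Cod \<C> f = X" "Cod \<C> g = Y" "Cod \<C> h = Z"
  shows "\<alpha>' X Y Z \<cdot> (f \<otimes> (g \<otimes> h)) = ((f \<otimes> g) \<otimes> h) \<cdot> \<alpha>' (Dom \<C> f) (Dom \<C> g) (Dom \<C> h)"
proof -
  have Obj: "X \<in> Obj \<C>" "Y \<in> Obj \<C>" "Z \<in> Obj \<C>"
    using assms by auto
  have "\<alpha>' X Y Z \<cdot> (f \<otimes> (g \<otimes> h)) =
      \<alpha>' X Y Z \<cdot> ((f \<otimes> (g \<otimes> h)) \<cdot> \<alpha> (Dom \<C> f) (Dom \<C> g) (Dom \<C> h)) \<cdot> \<alpha>' (Dom \<C> f) (Dom \<C> g) (Dom \<C> h)"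
    using assms by simp
  also have "\<dots> = (\<alpha>' X Y Z \<cdot> \<alpha> X Y Z) \<cdot> ((f \<otimes> g) \<otimes> h) \<cdot> \<alpha>' (Dom \<C> f) (Dom \<C> g) (Dom \<C> h)"
    using assms Obj by (subst Assoc_nat [symmetric]) (auto simp del: iso_inv_arr(4,5))
  also have "\<dots> = ((f \<otimes> g) \<otimes> h) \<cdot> \<alpha>' (Dom \<C> f) (Dom \<C> g) (Dom \<C> h)"
    using assms Obj by simp
  finally show ?thesis .
qed

lemma Sym_nat:
  "\<lbrakk>f \<in> Arr \<C>; g \<in> Arr \<C>; Cod \<C> f = X; Cod \<C> g = Y\<rbrakk>
    \<Longrightarrow> \<sigma> X Y \<cdot> (f \<otimes> g) = (g \<otimes> f) \<cdot> \<sigma> (Dom \<C> f) (Dom \<C> g)"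
  by (rule Sym_natural) (simp_all add: hom_def)

lemma LUnit_nat:
  "\<lbrakk>f \<in> Arr \<C>; Cod \<C> f = X\<rbrakk> \<Longrightarrow> \<lambda>\<^sub>u X \<cdot> (\<i> \<I> \<otimes> f) = f \<cdot> \<lambda>\<^sub>u (Dom \<C> f)"
  by (rule LUnit_natural) (simp_all add: hom_def)

lemma RUnit_nat:
  "\<lbrakk>f \<in> Arr \<C>; Cod \<C> f = X\<rbrakk> \<Longrightarrow> \<rho>\<^sub>u X \<cdot> (f \<otimes> \<i> \<I>) = f \<cdot> \<rho>\<^sub>u (Dom \<C> f)"
  by (rule RUnit_natural) (simp_all add: hom_def)

lemma mid_swap_Arr [simp]:
  assumes "W \<in> Obj \<C>" "X \<in> Obj \<C>" "Y \<in> Obj \<C>" "Z \<in> Obj \<C>"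
  shows "\<mu> W X Y Z \<in> Arr \<C>" "Dom \<C> (\<mu> W X Y Z) = (W \<odot> X) \<odot> (Y \<odot> Z)"
    "Cod \<C> (\<mu> W X Y Z) = (W \<odot> Y) \<odot> (X \<odot> Z)"
  using assms by (simp_all add: mid_swap_def)

lemma mid_swap_nat:
  assumes "f \<in> Arr \<C>" "g \<in> Arr \<C>" "h \<in> Arr \<C>" "k \<in> Arr \<C>"
    and "Cod \<C> f = W" "Cod \<C> g = X" "Cod \<C> h = Y" "Cod \<C> k = Z"
  shows "\<mu> W X Y Z \<cdot> ((f \<otimes> g) \<otimes> (h \<otimes> k))
    = ((f \<otimes> h) \<otimes> (g \<otimes> k)) \<cdot> \<mu> (Dom \<C> f) (Dom \<C> g) (Dom \<C> h) (Dom \<C> k)"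
proof -
  \<comment> \<open>\<open>m\<close> is the inner factor of \<open>mid_swap\<close>; its naturality
    combines those of the inverse associator, the symmetry and the associator.\<close>
  define m where "m X Y Z = \<alpha> Y X Z \<cdot> (\<sigma> X Y \<otimes> \<i> Z) \<cdot> \<alpha>' X Y Z" for X Y Z
  have m [simp]: "m X Y Z \<in> Arr \<C>" "Dom \<C> (m X Y Z) = X \<odot> (Y \<odot> Z)" "Cod \<C> (m X Y Z) = Y \<odot> (X \<odot> Z)"
    if "X \<in> Obj \<C>" "Y \<in> Obj \<C>" "Z \<in> Obj \<C>" for X Y Z
    using that by (simp_all add: m_def)
  have Obj [simp]: "W \<in> Obj \<C>" "X \<in> Obj \<C>" "Y \<in> Obj \<C>" "Z \<in> Obj \<C>"
    using assms by auto
  note assms [simp]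
  let ?a = "Dom \<C> f" and ?b = "Dom \<C> g" and ?c = "Dom \<C> h" and ?d = "Dom \<C> k"
  have 1: "m X Y Z \<cdot> (g \<otimes> (h \<otimes> k)) = (h \<otimes> (g \<otimes> k)) \<cdot> m ?b ?c ?d"
  proof -
    have "m X Y Z \<cdot> (g \<otimes> (h \<otimes> k)) = \<alpha> Y X Z \<cdot> ((\<sigma> X Y \<cdot> (g \<otimes> h)) \<otimes> k) \<cdot> \<alpha>' ?b ?c ?d"
      by (simp add: m_def Assoc_inv_nat)
    also have "\<dots> = \<alpha> Y X Z \<cdot> ((h \<otimes> g) \<otimes> k) \<cdot> (\<sigma> ?b ?c \<otimes> \<i> ?d) \<cdot> \<alpha>' ?b ?c ?d"
      by (simp add: Sym_nat)
    also have "\<dots> = (h \<otimes> (g \<otimes> k)) \<cdot> m ?b ?c ?d"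
      by (simp add: m_def Comp_cong_right [OF Assoc_nat] del: TensorA_Comp_left)
    finally show ?thesis .
  qed
  have "\<mu> W X Y Z \<cdot> ((f \<otimes> g) \<otimes> (h \<otimes> k)) = \<alpha>' W Y (X \<odot> Z) \<cdot> (f \<otimes> (m X Y Z \<cdot> (g \<otimes> (h \<otimes> k)))) \<cdot> \<alpha> ?a ?b (?c \<odot> ?d)"
    by (simp add: mid_swap_def Assoc_nat m_def [symmetric])
  also have "\<dots> = \<alpha>' W Y (X \<odot> Z) \<cdot> (f \<otimes> (h \<otimes> (g \<otimes> k))) \<cdot> (\<i> ?a \<otimes> m ?b ?c ?d) \<cdot> \<alpha> ?a ?b (?c \<odot> ?d)"
    by (simp add: 1)
  also have "\<dots> = ((f \<otimes> h) \<otimes> (g \<otimes> k)) \<cdot> \<mu> ?a ?b ?c ?d"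
    by (simp add: mid_swap_def m_def [symmetric] Comp_cong_right [OF Assoc_inv_nat] del: TensorA_Comp_left)
  finally show ?thesis .
qed

end

section \<open>Pairing, weighting and deterministic arrows\<close>

context cd_category
begin

text \<open>For deterministic arrows this is the pairing into a cartesian product. The common domain
  is read off the first component, so later facts require
  \<open>Dom \<C> g = Dom \<C> f\<close>.\<close>

definition pair :: "'m \<Rightarrow> 'm \<Rightarrow> 'm" (\<open>\<langle>_,/ _\<rangle>\<close>) where
  "\<langle>f, g\<rangle> = (f \<otimes> g) \<cdot> \<Delta> (Dom \<C> f)"

definition proj1 :: "'o \<Rightarrow> 'o \<Rightarrow> 'm" where
  "proj1 X Y = \<rho>\<^sub>u X \<cdot> (\<i> X \<otimes> \<epsilon> Y)"

definition proj2 :: "'o \<Rightarrow> 'o \<Rightarrow> 'm" where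
  "proj2 X Y = \<lambda>\<^sub>u Y \<cdot> (\<epsilon> X \<otimes> \<i> Y)"

definition total :: "'m \<Rightarrow> bool" where
  "total f \<longleftrightarrow> f \<in> Arr \<C> \<and> \<epsilon> (Cod \<C> f) \<cdot> f = \<epsilon> (Dom \<C> f)"

definition det :: "'m \<Rightarrow> bool" where
  "det f \<longleftrightarrow> total f \<and> \<Delta> (Cod \<C> f) \<cdot> f = (f \<otimes> f) \<cdot> \<Delta> (Dom \<C> f)"

text \<open>For an effect \<open>e\<close> on the domain of \<open>f\<close>, the arrow \<open>f\<close> reweighted by \<open>e\<close>. When \<open>f\<close> is an
  effect as well, this is the commutative multiplication of effects.\<close>

definition weight :: "'m \<Rightarrow> 'm \<Rightarrow> 'm" (infixl \<open>\<star>\<close> 60) where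
  "f \<star> e = \<rho>\<^sub>u (Cod \<C> f) \<cdot> \<langle>f, e\<rangle>"

lemma Copy_Arr [simp]: "X \<in> Obj \<C> \<Longrightarrow> \<Delta> X \<in> Arr \<C>" "X \<in> Obj \<C> \<Longrightarrow> Dom \<C> (\<Delta> X) = X"
  "X \<in> Obj \<C> \<Longrightarrow> Cod \<C> (\<Delta> X) = X \<odot> X"
  using Copy_hom homD by blast+

lemma Discard_Arr [simp]: "X \<in> Obj \<C> \<Longrightarrow> \<epsilon> X \<in> Arr \<C>" "X \<in> Obj \<C> \<Longrightarrow> Dom \<C> (\<epsilon> X) = X"
  "X \<in> Obj \<C> \<Longrightarrow> Cod \<C> (\<epsilon> X) = \<I>"
  using Discard_hom homD by blast+

lemma pair_Arr [simp]:
  assumes "f \<in> Arr \<C>" "g \<in> Arr \<C>" "Dom \<C> g = Dom \<C> f"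
  shows "\<langle>f, g\<rangle> \<in> Arr \<C>" "Dom \<C> \<langle>f, g\<rangle> = Dom \<C> f" "Cod \<C> \<langle>f, g\<rangle> = Cod \<C> f \<odot> Cod \<C> g"
  using assms by (simp_all add: pair_def)

lemma proj_Arr [simp]:
  assumes "X \<in> Obj \<C>" "Y \<in> Obj \<C>"
  shows "proj1 X Y \<in> Arr \<C>" "Dom \<C> (proj1 X Y) = X \<odot> Y" "Cod \<C> (proj1 X Y) = X"
    "proj2 X Y \<in> Arr \<C>" "Dom \<C> (proj2 X Y) = X \<odot> Y" "Cod \<C> (proj2 X Y) = Y"
  using assms by (simp_all add: proj1_def proj2_def)

lemma weight_Arr [simp]:
  assumes "f \<in> Arr \<C>" "e \<in> Arr \<C>" "Dom \<C> e = Dom \<C> f" "Cod \<C> e = \<I>"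
  shows "f \<star> e \<in> Arr \<C>" "Dom \<C> (f \<star> e) = Dom \<C> f" "Cod \<C> (f \<star> e) = Cod \<C> f"
  using assms by (simp_all add: weight_def)

lemma total_Arr: "total f \<Longrightarrow> f \<in> Arr \<C>"
  by (simp add: total_def)

lemma det_Arr: "det f \<Longrightarrow> f \<in> Arr \<C>"
  by (simp add: det_def total_def)

lemma det_total [simp]: "det f \<Longrightarrow> total f"
  by (simp add: det_def)

lemma total_Discard [simp]: "\<lbrakk>total f; Cod \<C> f = Y\<rbrakk> \<Longrightarrow> \<epsilon> Y \<cdot> f = \<epsilon> (Dom \<C> f)"
  by (auto simp: total_def)

lemma total_Discard_left [simp]:
  "\<lbrakk>total f; g \<in> Arr \<C>; Dom \<C> f = Cod \<C> g; Cod \<C> f = Y\<rbrakk> \<Longrightarrow> \<epsilon> Y \<cdot> (f \<cdot> g) = \<epsilon> (Dom \<C> f) \<cdot> g"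
  using total_Arr by (intro Comp_cong_right) auto

text \<open>Copying slides past \<open>h\<close> because \<open>h\<close> is deterministic; a
  general \<open>h\<close> would be run once on the left and twice on the right.\<close>

lemma pair_Comp [simp]:
  assumes "det h" "f \<in> Arr \<C>" "g \<in> Arr \<C>" "Dom \<C> f = Cod \<C> h" "Dom \<C> g = Cod \<C> h"
  shows "\<langle>f, g\<rangle> \<cdot> h = \<langle>f \<cdot> h, g \<cdot> h\<rangle>"
proof -
  have "h \<in> Arr \<C>" "\<Delta> (Cod \<C> h) \<cdot> h = (h \<otimes> h) \<cdot> \<Delta> (Dom \<C> h)"
    using assms(1) by (auto simp: det_def total_def)
  then show ?thesis
    using assms(2-5) by (simp add: pair_def)
qed

lemma TensorA_pair [simp]:
  assumes "f \<in> Arr \<C>" "g \<in> Arr \<C>" "a \<in> Arr \<C>" "b \<in> Arr \<C>"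
    and "Dom \<C> g = Dom \<C> f" "Dom \<C> a = Cod \<C> f" "Dom \<C> b = Cod \<C> g"
  shows "(a \<otimes> b) \<cdot> \<langle>f, g\<rangle> = \<langle>a \<cdot> f, b \<cdot> g\<rangle>"
  using assms by (simp add: pair_def)

text \<open>Naturality moves the associator past the components, where it meets two nested copies
  and coassociativity applies.\<close>

lemma Assoc_pair [simp]:
  assumes "f \<in> Arr \<C>" "g \<in> Arr \<C>" "h \<in> Arr \<C>" "Dom \<C> g = Dom \<C> f" "Dom \<C> h = Dom \<C> f"
    and "Cod \<C> f = X" "Cod \<C> g = Y" "Cod \<C> h = Z"
  shows "\<alpha> X Y Z \<cdot> \<langle>\<langle>f, g\<rangle>, h\<rangle> = \<langle>f, \<langle>g, h\<rangle>\<rangle>"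
proof -
  let ?W = "Dom \<C> f"
  have Obj: "X \<in> Obj \<C>" "Y \<in> Obj \<C>" "Z \<in> Obj \<C>"
    using assms by auto
  note assms(1-5) [simp]
  have "\<langle>\<langle>f, g\<rangle>, h\<rangle> = ((f \<otimes> g) \<otimes> h) \<cdot> (\<Delta> ?W \<otimes> \<i> ?W) \<cdot> \<Delta> ?W"
    by (simp add: pair_def)
  then have "\<alpha> X Y Z \<cdot> \<langle>\<langle>f, g\<rangle>, h\<rangle> = (f \<otimes> (g \<otimes> h)) \<cdot> \<alpha> ?W ?W ?W \<cdot> (\<Delta> ?W \<otimes> \<i> ?W) \<cdot> \<Delta> ?W"
    using assms(6-8) Obj by (simp add: Comp_cong_right [OF Assoc_nat] del: TensorA_Comp_left)
  also have "\<dots> = (f \<otimes> (g \<otimes> h)) \<cdot> (\<i> ?W \<otimes> \<Delta> ?W) \<cdot> \<Delta> ?W"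
    by (simp add: Copy_coassoc)
  also have "\<dots> = \<langle>f, \<langle>g, h\<rangle>\<rangle>"
    by (simp add: pair_def)
  finally show ?thesis .
qed

lemma Assoc_inv_pair [simp]:
  assumes "f \<in> Arr \<C>" "g \<in> Arr \<C>" "h \<in> Arr \<C>" "Dom \<C> g = Dom \<C> f" "Dom \<C> h = Dom \<C> f"
    and "Cod \<C> f = X" "Cod \<C> g = Y" "Cod \<C> h = Z"
  shows "\<alpha>' X Y Z \<cdot> \<langle>f, \<langle>g, h\<rangle>\<rangle> = \<langle>\<langle>f, g\<rangle>, h\<rangle>"
proof -
  have Obj: "X \<in> Obj \<C>" "Y \<in> Obj \<C>" "Z \<in> Obj \<C>"
    using assms by auto
  have "\<alpha>' X Y Z \<cdot> \<langle>f, \<langle>g, h\<rangle>\<rangle> = \<alpha>' X Y Z \<cdot> (\<alpha> X Y Z \<cdot> \<langle>\<langle>f, g\<rangle>, h\<rangle>)"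
    using assms by simp
  also have "\<dots> = (\<alpha>' X Y Z \<cdot> \<alpha> X Y Z) \<cdot> \<langle>\<langle>f, g\<rangle>, h\<rangle>"
    using assms Obj by (intro Comp_assoc' [symmetric]) auto
  finally show ?thesis
    using assms Obj by simp
qed

lemma Sym_pair [simp]:
  assumes "f \<in> Arr \<C>" "g \<in> Arr \<C>" "Dom \<C> g = Dom \<C> f" "Cod \<C> f = X" "Cod \<C> g = Y"
  shows "\<sigma> X Y \<cdot> \<langle>f, g\<rangle> = \<langle>g, f\<rangle>"
  using assms Cod_Obj [of f] Cod_Obj [of g] by (simp add: pair_def Comp_cong_right [OF Sym_nat] Copy_commute del: Cod_Obj)

lemma mid_swap_pair [simp]:
  assumes "f \<in> Arr \<C>" "g \<in> Arr \<C>" "h \<in> Arr \<C>" "k \<in> Arr \<C>"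
    and "Dom \<C> g = Dom \<C> f" "Dom \<C> h = Dom \<C> f" "Dom \<C> k = Dom \<C> f"
    and "Cod \<C> f = W" "Cod \<C> g = X" "Cod \<C> h = Y" "Cod \<C> k = Z"
  shows "\<mu> W X Y Z \<cdot> \<langle>\<langle>f, g\<rangle>, \<langle>h, k\<rangle>\<rangle> = \<langle>\<langle>f, h\<rangle>, \<langle>g, k\<rangle>\<rangle>"
proof -
  have Obj: "W \<in> Obj \<C>" "X \<in> Obj \<C>" "Y \<in> Obj \<C>" "Z \<in> Obj \<C>"
    using assms by auto
  show ?thesis
    using assms Obj by (simp add: mid_swap_def)
qed

text \<open>\<open>\<Delta> \<I>\<close> is the inverse of the left unitor, hence invertible, so
  commutativity of copying at the unit forces the symmetry there to be the identity.\<close>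

lemma Sym_Unit [simp]: "\<sigma> \<I> \<I> = \<i> (\<I> \<odot> \<I>)"
proof -
  have "\<sigma> \<I> \<I> = (\<sigma> \<I> \<I> \<cdot> \<Delta> \<I>) \<cdot> \<lambda>\<^sub>u \<I>"
    using Copy_Unit by (simp del: Copy_commute)
  also have "\<dots> = \<i> (\<I> \<odot> \<I>)"
    using Copy_Unit Copy_commute [of \<I>] by simp
  finally show ?thesis .
qed

text \<open>At the unit the right counit law reads
  \<open>\<rho>\<^sub>u \<I> \<cdot> \<Delta> \<I> = \<i> \<I>\<close>, and
  \<open>\<Delta> \<I>\<close> is already the inverse of the left unitor.\<close>

lemma LUnit_Unit: "\<lambda>\<^sub>u \<I> = \<rho>\<^sub>u \<I>"
proof -
  have "\<rho>\<^sub>u \<I> = (\<rho>\<^sub>u \<I> \<cdot> \<Delta> \<I>) \<cdot> \<lambda>\<^sub>u \<I>"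
    using Copy_Unit by simp
  also have "\<dots> = \<lambda>\<^sub>u \<I>"
    using Copy_counit_right [of \<I>] by (simp add: Discard_Unit)
  finally show ?thesis by simp
qed

lemma LUnit_pair [simp]:
  assumes "f \<in> Arr \<C>" "Cod \<C> f = X" "Dom \<C> f = W"
  shows "\<lambda>\<^sub>u X \<cdot> \<langle>\<epsilon> W, f\<rangle> = f"
proof -
  have W: "W \<in> Obj \<C>" "X \<in> Obj \<C>" using assms by auto
  have "\<langle>\<epsilon> W, f\<rangle> = (\<i> \<I> \<otimes> f) \<cdot> (\<epsilon> W \<otimes> \<i> W) \<cdot> \<Delta> W"
    using assms W by (simp add: pair_def)
  then have "\<lambda>\<^sub>u X \<cdot> \<langle>\<epsilon> W, f\<rangle> = f \<cdot> \<lambda>\<^sub>u W \<cdot> (\<epsilon> W \<otimes> \<i> W) \<cdot> \<Delta> W"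
    using assms W by (simp add: Comp_cong_right [OF LUnit_nat] del: TensorA_Comp_left)
  then show ?thesis
    using assms W by (simp add: Copy_counit_left)
qed

lemma RUnit_pair [simp]:
  assumes "f \<in> Arr \<C>" "Cod \<C> f = X" "Dom \<C> f = W"
  shows "\<rho>\<^sub>u X \<cdot> \<langle>f, \<epsilon> W\<rangle> = f"
proof -
  have W: "W \<in> Obj \<C>" "X \<in> Obj \<C>" using assms by auto
  have "\<langle>f, \<epsilon> W\<rangle> = (f \<otimes> \<i> \<I>) \<cdot> (\<i> W \<otimes> \<epsilon> W) \<cdot> \<Delta> W"
    using assms W by (simp add: pair_def)
  then have "\<rho>\<^sub>u X \<cdot> \<langle>f, \<epsilon> W\<rangle> = f \<cdot> \<rho>\<^sub>u W \<cdot> (\<i> W \<otimes> \<epsilon> W) \<cdot> \<Delta> W"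
    using assms W by (simp add: Comp_cong_right [OF RUnit_nat] del: TensorA_Comp_left)
  then show ?thesis
    using assms W by (simp add: Copy_counit_right)
qed

lemma LUnit_inv: "X \<in> Obj \<C> \<Longrightarrow> inv_arr \<C> (\<lambda>\<^sub>u X) = \<langle>\<epsilon> X, \<i> X\<rangle>"
  by (rule inv_arr_eqI_right) simp_all

lemma RUnit_inv: "X \<in> Obj \<C> \<Longrightarrow> inv_arr \<C> (\<rho>\<^sub>u X) = \<langle>\<i> X, \<epsilon> X\<rangle>"
  by (rule inv_arr_eqI_right) simp_all

section \<open>Deterministic arrows and projections out of a tensor product\<close>

lemma det_Id [simp]: "X \<in> Obj \<C> \<Longrightarrow> det (\<i> X)"
  by (simp add: det_def total_def)

lemma total_Comp [simp]:
  assumes "total f" "total g" "Dom \<C> g = Cod \<C> f"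
  shows "total (g \<cdot> f)"
proof -
  have [simp]: "f \<in> Arr \<C>" "g \<in> Arr \<C>"
    using assms total_Arr by auto
  then have "\<epsilon> (Cod \<C> g) \<cdot> (g \<cdot> f) = \<epsilon> (Dom \<C> f)"
    using assms by simp
  then show ?thesis
    using assms(3) by (simp add: total_def)
qed

lemma det_Comp [simp]:
  assumes "det f" "det g" "Dom \<C> g = Cod \<C> f"
  shows "det (g \<cdot> f)"
proof -
  have [simp]: "f \<in> Arr \<C>" "g \<in> Arr \<C>"
    using assms det_Arr by auto
  have "\<Delta> (Cod \<C> g) \<cdot> g \<cdot> f = ((g \<otimes> g) \<cdot> \<Delta> (Dom \<C> g)) \<cdot> f"
    using assms(2,3) by (intro Comp_cong_right) (simp_all add: det_def)
  also have "\<dots> = ((g \<cdot> f) \<otimes> (g \<cdot> f)) \<cdot> \<Delta> (Dom \<C> f)"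
    using assms(1,3) by (simp add: det_def)
  finally show ?thesis
    using assms by (simp add: det_def)
qed

text \<open>Copying on a tensor product is a middle swap after two copies, and the middle swap
  regroups \<open>\<langle>\<langle>f, f\<rangle>, \<langle>g, g\<rangle>\<rangle>\<close> as two
  copies of \<open>\<langle>f, g\<rangle>\<close>.\<close>

lemma det_pair [simp]:
  assumes "det f" "det g" "Dom \<C> g = Dom \<C> f"
  shows "det \<langle>f, g\<rangle>"
proof -
  have [simp]: "f \<in> Arr \<C>" "g \<in> Arr \<C>"
    using assms det_Arr by auto
  have f: "\<Delta> (Cod \<C> f) \<cdot> f = \<langle>f, f\<rangle>" and g: "\<Delta> (Cod \<C> g) \<cdot> g = \<langle>g, g\<rangle>"
    using assms by (simp_all add: det_def pair_def)
  have "\<langle>\<langle>f, g\<rangle>, \<langle>f, g\<rangle>\<rangle> = (\<langle>f, g\<rangle> \<otimes> \<langle>f, g\<rangle>) \<cdot> \<Delta> (Dom \<C> f)"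
    using assms by (simp add: pair_def)
  moreover have "\<Delta> (Cod \<C> f \<odot> Cod \<C> g) \<cdot> \<langle>f, g\<rangle> = \<langle>\<langle>f, g\<rangle>, \<langle>f, g\<rangle>\<rangle>"
    using assms f g by (simp add: Copy_Tensor)
  moreover have "\<epsilon> (Cod \<C> f \<odot> Cod \<C> g) \<cdot> \<langle>f, g\<rangle> = \<epsilon> (Dom \<C> f)"
    using assms by (simp add: Discard_Tensor)
  ultimately show ?thesis
    using assms by (simp add: det_def total_def)
qed

lemma det_TensorA [simp]:
  assumes "det f" "det g"
  shows "det (f \<otimes> g)"
proof -
  have [simp]: "f \<in> Arr \<C>" "g \<in> Arr \<C>"
    using assms det_Arr by auto
  have *: "\<Delta> (Cod \<C> f) \<cdot> f = (f \<otimes> f) \<cdot> \<Delta> (Dom \<C> f)" "\<Delta> (Cod \<C> g) \<cdot> g = (g \<otimes> g) \<cdot> \<Delta> (Dom \<C> g)"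
    using assms by (simp_all add: det_def)
  have "\<Delta> (Cod \<C> f \<odot> Cod \<C> g) \<cdot> (f \<otimes> g)
      = \<mu> (Cod \<C> f) (Cod \<C> f) (Cod \<C> g) (Cod \<C> g) \<cdot> ((f \<otimes> f) \<otimes> (g \<otimes> g)) \<cdot> (\<Delta> (Dom \<C> f) \<otimes> \<Delta> (Dom \<C> g))"
    using assms * by (simp add: Copy_Tensor)
  also have "\<dots> = ((f \<otimes> g) \<otimes> (f \<otimes> g)) \<cdot> \<Delta> (Dom \<C> f \<odot> Dom \<C> g)"
    by (simp add: Comp_cong_right [OF mid_swap_nat] Copy_Tensor del: TensorA_Comp' TensorA_Comp_left)
  moreover have "\<epsilon> (Cod \<C> f \<odot> Cod \<C> g) \<cdot> (f \<otimes> g) = \<epsilon> (Dom \<C> f \<odot> Dom \<C> g)"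
    using assms by (simp add: Discard_Tensor)
  ultimately show ?thesis
    by (simp add: det_def total_def)
qed

lemma det_inv:
  assumes "det f" "g \<in> Arr \<C>" "Dom \<C> g = Cod \<C> f" "Cod \<C> g = Dom \<C> f"
    and gf: "g \<cdot> f = \<i> (Dom \<C> f)" and fg: "f \<cdot> g = \<i> (Cod \<C> f)"
  shows "det g"
proof -
  note [simp] = det_Arr [OF assms(1)]
  have f: "\<Delta> (Cod \<C> f) \<cdot> f = (f \<otimes> f) \<cdot> \<Delta> (Dom \<C> f)" "\<epsilon> (Cod \<C> f) \<cdot> f = \<epsilon> (Dom \<C> f)"
    using assms by (simp_all add: det_def)
  have "\<epsilon> (Dom \<C> f) \<cdot> g = \<epsilon> (Cod \<C> f) \<cdot> (f \<cdot> g)"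
    using assms f by (intro Comp_cong_right [symmetric]) simp_all
  moreover have "\<Delta> (Dom \<C> f) \<cdot> g = (g \<otimes> g) \<cdot> (f \<otimes> f) \<cdot> \<Delta> (Dom \<C> f) \<cdot> g"
    using assms by simp
  moreover have "\<dots> = (g \<otimes> g) \<cdot> \<Delta> (Cod \<C> f) \<cdot> (f \<cdot> g)"
    by (subst f(1) [THEN Comp_cong_right]) (use assms in \<open>simp_all del: TensorA_Comp_left\<close>)
  ultimately show ?thesis
    using assms by (simp add: det_def total_def)
qed

lemma det_Discard [simp]:
  assumes "X \<in> Obj \<C>"
  shows "det (\<epsilon> X)"
proof -
  \<comment> \<open>The counit law rewrites \<open>\<epsilon> X\<close> as the unitor after
    \<open>\<langle>\<epsilon> X, \<epsilon> X\<rangle>\<close>, and \<open>\<Delta> \<I>\<close> is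
    the inverse of that unitor.\<close>
  have "\<Delta> \<I> \<cdot> \<epsilon> X = inv_arr \<C> (\<lambda>\<^sub>u \<I>) \<cdot> (\<lambda>\<^sub>u \<I> \<cdot> \<langle>\<epsilon> X, \<epsilon> X\<rangle>)"
    using assms by (simp add: Copy_Unit)
  also have "\<dots> = (inv_arr \<C> (\<lambda>\<^sub>u \<I>) \<cdot> \<lambda>\<^sub>u \<I>) \<cdot> \<langle>\<epsilon> X, \<epsilon> X\<rangle>"
    using assms by (intro Comp_assoc' [symmetric]) simp_all
  also have "\<dots> = (\<epsilon> X \<otimes> \<epsilon> X) \<cdot> \<Delta> X"
    using assms by (simp add: pair_def)
  finally show ?thesis
    using assms by (simp add: det_def total_def Discard_Unit)
qed

lemma det_Copy_Comp: "\<lbrakk>det f; Cod \<C> f = X\<rbrakk> \<Longrightarrow> \<Delta> X \<cdot> f = \<langle>f, f\<rangle>"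
  by (auto simp: det_def pair_def)

lemma Copy_eq_pair: "X \<in> Obj \<C> \<Longrightarrow> \<Delta> X = \<langle>\<i> X, \<i> X\<rangle>"
  by (simp add: pair_def)

text \<open>The unitor is the inverse of \<open>\<langle>\<i> X, \<epsilon> X\<rangle>\<close>, a
  pair of deterministic arrows, and determinism passes to inverses.\<close>

lemma det_RUnit [simp]:
  assumes "X \<in> Obj \<C>"
  shows "det (\<rho>\<^sub>u X)"
proof (rule det_inv [of "\<langle>\<i> X, \<epsilon> X\<rangle>"])
  show "\<langle>\<i> X, \<epsilon> X\<rangle> \<cdot> \<rho>\<^sub>u X = \<i> (Cod \<C> \<langle>\<i> X, \<epsilon> X\<rangle>)"
    using assms by (simp flip: RUnit_inv)
qed (use assms in simp_all)

lemma det_LUnit [simp]: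
  assumes "X \<in> Obj \<C>"
  shows "det (\<lambda>\<^sub>u X)"
proof (rule det_inv [of "\<langle>\<epsilon> X, \<i> X\<rangle>"])
  show "\<langle>\<epsilon> X, \<i> X\<rangle> \<cdot> \<lambda>\<^sub>u X = \<i> (Cod \<C> \<langle>\<epsilon> X, \<i> X\<rangle>)"
    using assms by (simp flip: LUnit_inv)
qed (use assms in simp_all)

lemma det_proj [simp]:
  "\<lbrakk>X \<in> Obj \<C>; Y \<in> Obj \<C>\<rbrakk> \<Longrightarrow> det (proj1 X Y)"
  "\<lbrakk>X \<in> Obj \<C>; Y \<in> Obj \<C>\<rbrakk> \<Longrightarrow> det (proj2 X Y)"
  by (simp_all add: proj1_def proj2_def)

lemma proj1_pair [simp]:
  assumes "f \<in> Arr \<C>" "total g" "Dom \<C> g = Dom \<C> f" "Cod \<C> f = X" "Cod \<C> g = Y"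
  shows "proj1 X Y \<cdot> \<langle>f, g\<rangle> = f"
proof -
  have "g \<in> Arr \<C>" "X \<in> Obj \<C>" "Y \<in> Obj \<C>"
    using assms total_Arr by auto
  then show ?thesis
    using assms by (simp add: proj1_def)
qed

lemma proj2_pair [simp]:
  assumes "total f" "g \<in> Arr \<C>" "Dom \<C> g = Dom \<C> f" "Cod \<C> f = X" "Cod \<C> g = Y"
  shows "proj2 X Y \<cdot> \<langle>f, g\<rangle> = g"
proof -
  have "f \<in> Arr \<C>" "X \<in> Obj \<C>" "Y \<in> Obj \<C>"
    using assms total_Arr by auto
  then show ?thesis
    using assms by (simp add: proj2_def)
qed

lemma mid_swap_Unit:
  assumes "X \<in> Obj \<C>" "Y \<in> Obj \<C>"
  shows "\<mu> X \<I> \<I> Y = \<i> ((X \<odot> \<I>) \<odot> (\<I> \<odot> Y))"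
  using assms by (simp add: mid_swap_def)

text \<open>Naturality pulls the two discards in front of the middle swap. Its two middle factors
  then become units, where the swap is trivial, and what remains are the two counit laws.\<close>

lemma pair_proj [simp]:
  assumes "X \<in> Obj \<C>" "Y \<in> Obj \<C>"
  shows "\<langle>proj1 X Y, proj2 X Y\<rangle> = \<i> (X \<odot> Y)"
proof -
  have "\<langle>proj1 X Y, proj2 X Y\<rangle>
      = (\<rho>\<^sub>u X \<otimes> \<lambda>\<^sub>u Y) \<cdot> ((\<i> X \<otimes> \<epsilon> Y) \<otimes> (\<epsilon> X \<otimes> \<i> Y)) \<cdot> \<mu> X X Y Y \<cdot> (\<Delta> X \<otimes> \<Delta> Y)"
    using assms by (simp add: pair_def proj1_def proj2_def Copy_Tensor)
  also have "\<dots> = (\<rho>\<^sub>u X \<otimes> \<lambda>\<^sub>u Y) \<cdot> (((\<i> X \<otimes> \<epsilon> Y) \<otimes> (\<epsilon> X \<otimes> \<i> Y)) \<cdot> \<mu> X X Y Y) \<cdot> (\<Delta> X \<otimes> \<Delta> Y)"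
    using assms by simp
  also have "((\<i> X \<otimes> \<epsilon> Y) \<otimes> (\<epsilon> X \<otimes> \<i> Y)) \<cdot> \<mu> X X Y Y
      = \<mu> X \<I> \<I> Y \<cdot> ((\<i> X \<otimes> \<epsilon> X) \<otimes> (\<epsilon> Y \<otimes> \<i> Y))"
    using assms by (simp add: mid_swap_nat)
  also have "(\<rho>\<^sub>u X \<otimes> \<lambda>\<^sub>u Y) \<cdot> \<dots> \<cdot> (\<Delta> X \<otimes> \<Delta> Y) = \<i> (X \<odot> Y)"
    using assms by (simp add: mid_swap_Unit Copy_counit_left Copy_counit_right)
  finally show ?thesis .
qed

lemma TensorA_eq_pair:
  assumes "f \<in> Arr \<C>" "g \<in> Arr \<C>"
  shows "f \<otimes> g = \<langle>f \<cdot> proj1 (Dom \<C> f) (Dom \<C> g), g \<cdot> proj2 (Dom \<C> f) (Dom \<C> g)\<rangle>"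
proof -
  have "f \<otimes> g = (f \<otimes> g) \<cdot> \<langle>proj1 (Dom \<C> f) (Dom \<C> g), proj2 (Dom \<C> f) (Dom \<C> g)\<rangle>"
    using assms by (subst pair_proj) simp_all
  also have "\<dots> = \<langle>f \<cdot> proj1 (Dom \<C> f) (Dom \<C> g), g \<cdot> proj2 (Dom \<C> f) (Dom \<C> g)\<rangle>"
    using assms by (subst TensorA_pair) simp_all
  finally show ?thesis .
qed

lemma pair_eta:
  assumes "det f" "Cod \<C> f = X \<odot> Y" "X \<in> Obj \<C>" "Y \<in> Obj \<C>"
  shows "f = \<langle>proj1 X Y \<cdot> f, proj2 X Y \<cdot> f\<rangle>"
  using pair_Comp [of f "proj1 X Y" "proj2 X Y"] assms det_Arr [of f] by simp

text \<open>Expanding the identity on the domain into nested projections lets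
  \<open>Assoc_pair\<close> evaluate the associator.\<close>

lemma Assoc_eq_pair:
  assumes "X \<in> Obj \<C>" "Y \<in> Obj \<C>" "Z \<in> Obj \<C>"
  shows "\<alpha> X Y Z = \<langle>proj1 X Y \<cdot> proj1 (X \<odot> Y) Z, \<langle>proj2 X Y \<cdot> proj1 (X \<odot> Y) Z, proj2 (X \<odot> Y) Z\<rangle>\<rangle>"
proof -
  have "\<alpha> X Y Z = \<alpha> X Y Z \<cdot> \<langle>proj1 (X \<odot> Y) Z, proj2 (X \<odot> Y) Z\<rangle>"
    using assms by (subst pair_proj) simp_all
  also have "proj1 (X \<odot> Y) Z = \<langle>proj1 X Y \<cdot> proj1 (X \<odot> Y) Z, proj2 X Y \<cdot> proj1 (X \<odot> Y) Z\<rangle>"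
    using assms by (intro pair_eta) simp_all
  finally show ?thesis
    using assms by (simp del: pair_Comp)
qed

lemma det_Assoc [simp]: "\<lbrakk>X \<in> Obj \<C>; Y \<in> Obj \<C>; Z \<in> Obj \<C>\<rbrakk> \<Longrightarrow> det (\<alpha> X Y Z)"
  by (simp add: Assoc_eq_pair)

lemma Sym_eq_pair: "\<lbrakk>X \<in> Obj \<C>; Y \<in> Obj \<C>\<rbrakk> \<Longrightarrow> \<sigma> X Y = \<langle>proj2 X Y, proj1 X Y\<rangle>"
  using Sym_pair [of "proj1 X Y" "proj2 X Y" X Y] by simp

lemma RUnit_eq_proj1: "X \<in> Obj \<C> \<Longrightarrow> \<rho>\<^sub>u X = proj1 X \<I>"
  by (simp add: proj1_def Discard_Unit)

lemma LUnit_eq_proj2: "X \<in> Obj \<C> \<Longrightarrow> \<lambda>\<^sub>u X = proj2 \<I> X"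
  by (simp add: proj2_def Discard_Unit)

section \<open>Weighting arrows by effects\<close>

lemma Comp_weight:
  assumes "f \<in> Arr \<C>" "e \<in> Arr \<C>" "h \<in> Arr \<C>" "Dom \<C> e = Dom \<C> f" "Cod \<C> e = \<I>" "Dom \<C> h = Cod \<C> f"
  shows "h \<cdot> (f \<star> e) = (h \<cdot> f) \<star> e"
proof -
  have "h \<cdot> (f \<star> e) = (h \<cdot> \<rho>\<^sub>u (Cod \<C> f)) \<cdot> \<langle>f, e\<rangle>"
    using assms by (simp add: weight_def)
  also have "h \<cdot> \<rho>\<^sub>u (Cod \<C> f) = \<rho>\<^sub>u (Cod \<C> h) \<cdot> (h \<otimes> \<i> \<I>)"
    using assms by (simp add: RUnit_nat)
  finally show ?thesis
    using assms by (simp add: weight_def)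
qed

text \<open>Both \<open>f\<close> and \<open>e\<close> consume the output of \<open>h\<close>, so
  here \<open>h\<close> must be deterministic, in contrast to postcomposition in
  \<open>Comp_weight\<close>.\<close>

lemma weight_Comp:
  assumes "f \<in> Arr \<C>" "e \<in> Arr \<C>" "det h" "Dom \<C> e = Dom \<C> f" "Cod \<C> e = \<I>" "Dom \<C> f = Cod \<C> h"
  shows "(f \<star> e) \<cdot> h = (f \<cdot> h) \<star> (e \<cdot> h)"
  using assms det_Arr [of h] by (simp add: weight_def)

lemma weight_Discard [simp]: "\<lbrakk>f \<in> Arr \<C>; Dom \<C> f = X\<rbrakk> \<Longrightarrow> f \<star> \<epsilon> X = f"
  by (simp add: weight_def)

lemma weight_comm:
  assumes "e \<in> Arr \<C>" "e' \<in> Arr \<C>" "Dom \<C> e' = Dom \<C> e" "Cod \<C> e = \<I>" "Cod \<C> e' = \<I>"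
  shows "e \<star> e' = e' \<star> e"
  using Sym_pair [of e e' \<I> \<I>] assms by (simp add: weight_def)

lemma Discard_weight [simp]:
  "\<lbrakk>e \<in> Arr \<C>; Dom \<C> e = X; Cod \<C> e = \<I>\<rbrakk> \<Longrightarrow> \<epsilon> X \<star> e = e"
  using weight_comm [of "\<epsilon> X" e] by auto

lemma LUnit_pair_weight:
  assumes "e \<in> Arr \<C>" "f \<in> Arr \<C>" "Dom \<C> e = Dom \<C> f" "Cod \<C> e = \<I>" "Cod \<C> f = X"
  shows "\<lambda>\<^sub>u X \<cdot> \<langle>e, f\<rangle> = f \<star> e"
proof -
  have X: "X \<in> Obj \<C>"
    using assms by auto
  have "\<lambda>\<^sub>u X = \<rho>\<^sub>u X \<cdot> \<sigma> \<I> X"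
    using X by (simp add: Sym_eq_pair RUnit_eq_proj1 LUnit_eq_proj2)
  then show ?thesis
    using assms X by (simp add: weight_def)
qed

lemma pair_weight_right:
  assumes "f \<in> Arr \<C>" "g \<in> Arr \<C>" "e \<in> Arr \<C>" "Dom \<C> g = Dom \<C> f" "Dom \<C> e = Dom \<C> f" "Cod \<C> e = \<I>"
  shows "\<langle>f, g \<star> e\<rangle> = \<langle>f, g\<rangle> \<star> e"
proof -
  let ?Y = "Cod \<C> f" and ?Z = "Cod \<C> g"
  have "\<langle>f, g\<rangle> \<star> e = \<rho>\<^sub>u (?Y \<odot> ?Z) \<cdot> \<langle>\<langle>f, g\<rangle>, e\<rangle>"
    using assms by (simp add: weight_def)
  also have "\<rho>\<^sub>u (?Y \<odot> ?Z) = (\<i> ?Y \<otimes> \<rho>\<^sub>u ?Z) \<cdot> \<alpha> ?Y ?Z \<I>"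
  proof -
    have "(\<i> ?Y \<otimes> \<rho>\<^sub>u ?Z) \<cdot> \<alpha> ?Y ?Z \<I>
        = \<langle>proj1 ?Y ?Z \<cdot> proj1 (?Y \<odot> ?Z) \<I>, proj2 ?Y ?Z \<cdot> proj1 (?Y \<odot> ?Z) \<I>\<rangle>"
      using assms by (simp add: Assoc_eq_pair RUnit_eq_proj1 del: pair_Comp)
    also have "\<dots> = proj1 (?Y \<odot> ?Z) \<I>"
      using assms by (intro pair_eta [symmetric]) simp_all
    finally show ?thesis
      using assms by (simp add: RUnit_eq_proj1)
  qed
  also have "\<dots> \<cdot> \<langle>\<langle>f, g\<rangle>, e\<rangle> = \<langle>f, g \<star> e\<rangle>"
    using assms by (simp add: weight_def)
  finally show ?thesis ..
qed

lemma pair_weight_left: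
  assumes "f \<in> Arr \<C>" "g \<in> Arr \<C>" "e \<in> Arr \<C>" "Dom \<C> g = Dom \<C> f" "Dom \<C> e = Dom \<C> f" "Cod \<C> e = \<I>"
  shows "\<langle>f \<star> e, g\<rangle> = \<langle>f, g\<rangle> \<star> e"
proof -
  have "\<langle>f \<star> e, g\<rangle> = \<sigma> (Cod \<C> g) (Cod \<C> f) \<cdot> \<langle>g, f \<star> e\<rangle>"
    using assms by simp
  also have "\<dots> = (\<sigma> (Cod \<C> g) (Cod \<C> f) \<cdot> \<langle>g, f\<rangle>) \<star> e"
    using assms by (simp only: pair_weight_right) (simp add: Comp_weight del: Sym_pair)
  also have "\<dots> = \<langle>f, g\<rangle> \<star> e"
    using assms by simp
  finally show ?thesis .
qed

lemma weight_assoc: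
  assumes "f \<in> Arr \<C>" "e \<in> Arr \<C>" "e' \<in> Arr \<C>" "Dom \<C> e = Dom \<C> f" "Dom \<C> e' = Dom \<C> f"
    "Cod \<C> e = \<I>" "Cod \<C> e' = \<I>"
  shows "f \<star> (e \<star> e') = (f \<star> e) \<star> e'"
proof -
  have "f \<star> (e \<star> e') = \<rho>\<^sub>u (Cod \<C> f) \<cdot> (\<langle>f, e\<rangle> \<star> e')"
    using assms by (simp add: weight_def [of f] pair_weight_right)
  also have "\<dots> = (f \<star> e) \<star> e'"
    using assms by (simp add: Comp_weight weight_def [of f])
  finally show ?thesis .
qed

lemma weight_right_comm:
  assumes "f \<in> Arr \<C>" "e \<in> Arr \<C>" "e' \<in> Arr \<C>" "Dom \<C> e = Dom \<C> f" "Dom \<C> e' = Dom \<C> f"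
    "Cod \<C> e = \<I>" "Cod \<C> e' = \<I>"
  shows "(f \<star> e) \<star> e' = (f \<star> e') \<star> e"
  using assms weight_comm [of e e'] by (simp flip: weight_assoc)

lemma partial_channel_iff:
  "partial_channel \<C> f \<longleftrightarrow> f \<in> Arr \<C> \<and> f \<star> (\<epsilon> (Cod \<C> f) \<cdot> f) = f"
  by (auto simp: partial_channel_def weight_def pair_def)

lemma partial_channel_total: "total f \<Longrightarrow> partial_channel \<C> f"
  using total_Arr [of f] by (simp add: partial_channel_iff)

lemma partial_channel_Comp:
  assumes "partial_channel \<C> f" "det h" "Dom \<C> f = Cod \<C> h"
  shows "partial_channel \<C> (f \<cdot> h)"
  using assms det_Arr [of h] weight_Comp [of f "\<epsilon> (Cod \<C> f) \<cdot> f" h] by (simp add: partial_channel_iff)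

text \<open>Discarding a component that need not be total does not remove it: its mass
  \<open>\<epsilon> Y \<cdot> g\<close> stays behind as a weight.\<close>

lemma proj1_pair_weight:
  assumes "f \<in> Arr \<C>" "g \<in> Arr \<C>" "Dom \<C> g = Dom \<C> f" "Cod \<C> f = X" "Cod \<C> g = Y"
  shows "proj1 X Y \<cdot> \<langle>f, g\<rangle> = f \<star> (\<epsilon> Y \<cdot> g)"
proof -
  have "X \<in> Obj \<C>" "Y \<in> Obj \<C>"
    using assms by auto
  then show ?thesis
    using assms by (simp add: proj1_def weight_def)
qed

end

section \<open>Normalisation and caps\<close>

context normalisation
begin

lemma Norm_Arr [simp]:
  assumes "f \<in> Arr \<C>"
  shows "Norm \<C> f \<in> Arr \<C>" "Dom \<C> (Norm \<C> f) = Dom \<C> f" "Cod \<C> (Norm \<C> f) = Cod \<C> f"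
  using Norm_hom [of f "Dom \<C> f" "Cod \<C> f"] assms by (simp_all add: hom_def)

lemma Norm_weight: "f \<in> Arr \<C> \<Longrightarrow> Norm \<C> f \<star> (\<epsilon> (Cod \<C> f) \<cdot> f) = f"
  using N0 [of f "Dom \<C> f" "Cod \<C> f"] by (simp add: hom_def weight_def pair_def)

lemma Norm_pair:
  "\<lbrakk>f \<in> Arr \<C>; g \<in> Arr \<C>; Dom \<C> g = Dom \<C> f\<rbrakk> \<Longrightarrow> Norm \<C> \<langle>f, g\<rangle> = \<langle>Norm \<C> f, Norm \<C> g\<rangle>"
  using N4 [of "Dom \<C> f" "f \<otimes> g" "Cod \<C> f \<odot> Cod \<C> g"] by (simp add: pair_def N2 hom_def)

text \<open>The normalisation axioms do not mention unitors. Since \<open>f\<close> equals the pair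
  of \<open>\<rho>\<^sub>u X \<cdot> f\<close> with a discard, \<open>Norm_pair\<close> applies, and
  (N1) fixes the discard because it is total.\<close>

lemma Norm_RUnit:
  assumes "f \<in> Arr \<C>" "Cod \<C> f = X \<odot> \<I>" "X \<in> Obj \<C>"
  shows "Norm \<C> (\<rho>\<^sub>u X \<cdot> f) = \<rho>\<^sub>u X \<cdot> Norm \<C> f"
proof -
  have inv: "inv_arr \<C> (\<rho>\<^sub>u X) \<cdot> g = \<langle>g, \<epsilon> (Dom \<C> g)\<rangle>" if "g \<in> Arr \<C>" "Cod \<C> g = X" for g
  proof -
    have "inv_arr \<C> (\<rho>\<^sub>u X) \<cdot> g = inv_arr \<C> (\<rho>\<^sub>u X) \<cdot> (\<rho>\<^sub>u X \<cdot> \<langle>g, \<epsilon> (Dom \<C> g)\<rangle>)"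
      using that assms by simp
    also have "\<dots> = (inv_arr \<C> (\<rho>\<^sub>u X) \<cdot> \<rho>\<^sub>u X) \<cdot> \<langle>g, \<epsilon> (Dom \<C> g)\<rangle>"
      using that assms by (intro Comp_assoc' [symmetric]) simp_all
    finally show ?thesis
      using that assms by simp
  qed
  let ?g = "\<rho>\<^sub>u X \<cdot> f"
  have "f = (inv_arr \<C> (\<rho>\<^sub>u X) \<cdot> \<rho>\<^sub>u X) \<cdot> f"
    using assms by simp
  also have "\<dots> = inv_arr \<C> (\<rho>\<^sub>u X) \<cdot> ?g"
    using assms by (intro Comp_assoc') simp_all
  finally have "f = \<langle>?g, \<epsilon> (Dom \<C> f)\<rangle>"
    using assms inv [of ?g] by simp
  then have "Norm \<C> f = \<langle>Norm \<C> ?g, \<epsilon> (Dom \<C> f)\<rangle>"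
    using Norm_pair [of ?g "\<epsilon> (Dom \<C> f)"] N1 [OF partial_channel_total, of "\<epsilon> (Dom \<C> f)"] assms by simp
  then show ?thesis
    using assms by simp
qed

lemma Norm_weight_distrib:
  assumes "f \<in> Arr \<C>" "e \<in> Arr \<C>" "Dom \<C> e = Dom \<C> f" "Cod \<C> e = \<I>"
  shows "Norm \<C> (f \<star> e) = Norm \<C> f \<star> Norm \<C> e"
  using assms by (simp add: weight_def Norm_RUnit Norm_pair)

text \<open>By (N0), \<open>h \<cdot> f\<close> is \<open>h \<cdot> Norm \<C> f\<close> weighted by
  the mass of \<open>f\<close>. As \<open>h\<close> is total, \<open>h \<cdot> Norm \<C> f\<close>
  is a partial channel with the same mass as \<open>Norm \<C> f\<close>; by (N3) this mass is also
  the normalised weight, so the weight is absorbed.\<close>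

lemma Norm_total_Comp:
  assumes "f \<in> Arr \<C>" "total h" "Dom \<C> h = Cod \<C> f"
  shows "Norm \<C> (h \<cdot> f) = h \<cdot> Norm \<C> f"
proof -
  note [simp] = total_Arr [OF assms(2)]
  let ?p = "h \<cdot> Norm \<C> f" and ?e = "\<epsilon> (Cod \<C> f) \<cdot> f"
  have pc: "Norm \<C> f \<star> (\<epsilon> (Cod \<C> f) \<cdot> Norm \<C> f) = Norm \<C> f"
    using Norm_partial_channel [OF assms(1)] assms by (simp add: partial_channel_iff)
  have p: "?p \<star> (\<epsilon> (Cod \<C> f) \<cdot> Norm \<C> f) = ?p"
    using assms pc by (simp flip: Comp_weight)
  then have "partial_channel \<C> ?p"
    using assms by (simp add: partial_channel_iff)
  moreover have "h \<cdot> f = ?p \<star> ?e"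
    using assms Norm_weight [of f] by (simp flip: Comp_weight)
  ultimately have "Norm \<C> (h \<cdot> f) = ?p \<star> Norm \<C> ?e"
    using assms by (simp add: Norm_weight_distrib N1)
  also have "Norm \<C> ?e = \<epsilon> (Cod \<C> f) \<cdot> Norm \<C> f"
    using assms by (intro N3) (simp add: hom_def)
  finally show ?thesis
    using p by simp
qed

text \<open>Naturality turns precomposition with a unitor into postcomposition, where
  \<open>Norm_total_Comp\<close> applies, and tensoring with an identity is covered by (N2) and
  (N1).\<close>

lemma Norm_LUnit_inv:
  assumes "f \<in> Arr \<C>" "Dom \<C> f = \<I> \<odot> X" "X \<in> Obj \<C>"
  shows "Norm \<C> f \<cdot> inv_arr \<C> (\<lambda>\<^sub>u X) = Norm \<C> (f \<cdot> inv_arr \<C> (\<lambda>\<^sub>u X))"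
proof -
  let ?Y = "Cod \<C> f" and ?g = "f \<cdot> inv_arr \<C> (\<lambda>\<^sub>u X)"
  have "f = ?g \<cdot> \<lambda>\<^sub>u X"
    using assms by simp
  also have "\<dots> = \<lambda>\<^sub>u ?Y \<cdot> (\<i> \<I> \<otimes> ?g)"
    using assms LUnit_nat [of ?g ?Y] by simp
  finally have "Norm \<C> f = Norm \<C> (\<lambda>\<^sub>u ?Y \<cdot> (\<i> \<I> \<otimes> ?g))"
    by simp
  also have "\<dots> = \<lambda>\<^sub>u ?Y \<cdot> (\<i> \<I> \<otimes> Norm \<C> ?g)"
    using assms by (subst Norm_total_Comp) (simp_all add: N2 N1 partial_channel_total)
  also have "\<dots> = Norm \<C> ?g \<cdot> \<lambda>\<^sub>u X"
    using assms by (subst LUnit_nat) simp_all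
  finally show ?thesis
    using assms by simp
qed

end

section \<open>Caps, their uniqueness and their invariance\<close>

context caps
begin

lemma Cap_Arr [simp]: "X \<in> Obj \<C> \<Longrightarrow> \<kappa> X \<in> Arr \<C>" "X \<in> Obj \<C> \<Longrightarrow> Dom \<C> (\<kappa> X) = X \<odot> X"
  "X \<in> Obj \<C> \<Longrightarrow> Cod \<C> (\<kappa> X) = \<I>"
  using Cap_hom homD by blast+

text \<open>This is the Frobenius-type axiom in projection form: weighted by the cap, the two
  arguments are interchangeable.\<close>

lemma Cap_slide:
  assumes X: "X \<in> Obj \<C>"
  shows "proj2 X X \<star> \<kappa> X = proj1 X X \<star> \<kappa> X"
proof -
  let ?p = "proj1 X X" and ?q = "proj2 X X"
  have "(\<i> X \<otimes> \<Delta> X) = \<langle>?p, \<langle>?q, ?q\<rangle>\<rangle>" "(\<Delta> X \<otimes> \<i> X) = \<langle>\<langle>?p, ?p\<rangle>, ?q\<rangle>"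
    using X by (simp_all add: TensorA_eq_pair det_Copy_Comp)
  then have "\<lambda>\<^sub>u X \<cdot> \<langle>\<kappa> X, ?q\<rangle> = \<rho>\<^sub>u X \<cdot> \<langle>?p, \<kappa> X\<rangle>"
    using Cap_Copy_slide [OF X] X by simp
  then show ?thesis
    using X by (simp add: LUnit_pair_weight) (simp add: weight_def)
qed

text \<open>A slidable effect moves both arguments of any other such effect onto the same value, and on
  equal arguments both are trivial. In particular caps are invariant under deterministic
  isomorphisms, although this is not among their axioms.\<close>

lemma Cap_unique:
  assumes X: "X \<in> Obj \<C>" and k: "k \<in> hom \<C> (X \<odot> X) \<I>"
    and Copy: "k \<cdot> \<Delta> X = \<epsilon> X" and slide: "proj2 X X \<star> k = proj1 X X \<star> k"
  shows "k = \<kappa> X"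
proof -
  let ?p = "proj1 X X" and ?q = "proj2 X X"
  have absorb: "e' \<star> e = e"
    if [simp]: "e \<in> Arr \<C>" "Dom \<C> e = X \<odot> X" "Cod \<C> e = \<I>" "e' \<in> Arr \<C>" "Dom \<C> e' = X \<odot> X" "Cod \<C> e' = \<I>"
      and e: "?q \<star> e = ?p \<star> e" and e': "e' \<cdot> \<Delta> X = \<epsilon> X" for e e'
  proof -
    \<comment> \<open>Under the weight \<open>e\<close> the second argument may be replaced by the
      first, so the identity becomes a copy of the first argument, on which \<open>e'\<close> is
      trivial.\<close>
    have "\<i> (X \<odot> X) \<star> e = \<langle>?p, ?q\<rangle> \<star> e"
      using X by simp
    also have "\<dots> = \<langle>?p, ?q \<star> e\<rangle>"
      using X by (subst pair_weight_right) simp_all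
    also have "\<dots> = (\<Delta> X \<cdot> ?p) \<star> e"
      using X e by (simp add: pair_weight_right det_Copy_Comp)
    finally have "e' \<cdot> (\<i> (X \<odot> X) \<star> e) = e' \<cdot> ((\<Delta> X \<cdot> ?p) \<star> e)"
      by simp
    moreover have "e' \<cdot> \<Delta> X \<cdot> ?p = \<epsilon> X \<cdot> ?p"
      using X e' by (intro Comp_cong_right) simp_all
    ultimately show ?thesis
      using X by (simp add: Comp_weight)
  qed
  have "k = \<kappa> X \<star> k"
    using k Copy slide X Cap_Copy by (intro absorb [symmetric]) (auto simp: hom_def)
  also have "\<dots> = k \<star> \<kappa> X"
    using k X by (simp add: weight_comm hom_def)
  also have "\<dots> = \<kappa> X"
    using k Copy slide X Cap_slide by (intro absorb) (auto simp: hom_def)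
  finally show ?thesis .
qed

text \<open>The transported cap satisfies the two laws of \<open>Cap_unique\<close>. The copy law
  uses that \<open>h\<close> is deterministic; the slide law is inherited after postcomposing with
  \<open>h\<close>, which \<open>g\<close> then cancels.\<close>

lemma Cap_iso:
  assumes h: "det h" and g: "g \<in> Arr \<C>" "Dom \<C> g = Cod \<C> h" "g \<cdot> h = \<i> (Dom \<C> h)"
  shows "\<kappa> (Cod \<C> h) \<cdot> (h \<otimes> h) = \<kappa> (Dom \<C> h)"
proof (rule Cap_unique)
  note [simp] = det_Arr [OF h]
  let ?X = "Dom \<C> h" and ?Y = "Cod \<C> h"
  let ?k = "\<kappa> ?Y \<cdot> (h \<otimes> h)"
  show "?k \<in> hom \<C> (?X \<odot> ?X) \<I>"
    by (simp add: hom_def)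
  have "(h \<otimes> h) \<cdot> \<Delta> ?X = \<Delta> ?Y \<cdot> h"
    using h by (simp add: det_def)
  then show "?k \<cdot> \<Delta> ?X = \<epsilon> ?X"
    using h by (simp add: Comp_cong_right [OF Cap_Copy])
  have "(proj2 ?Y ?Y \<star> \<kappa> ?Y) \<cdot> (h \<otimes> h) = (proj1 ?Y ?Y \<star> \<kappa> ?Y) \<cdot> (h \<otimes> h)"
    by (simp add: Cap_slide)
  then have "h \<cdot> (proj2 ?X ?X \<star> ?k) = h \<cdot> (proj1 ?X ?X \<star> ?k)"
    using h by (simp add: weight_Comp Comp_weight TensorA_eq_pair)
  then have *: "g \<cdot> h \<cdot> (proj2 ?X ?X \<star> ?k) = g \<cdot> h \<cdot> (proj1 ?X ?X \<star> ?k)"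
    by simp
  have cancel: "g \<cdot> h \<cdot> x = x" if "x \<in> Arr \<C>" "Cod \<C> x = ?X" for x
    using Comp_cong_right [OF g(3), of x] that g by simp
  have "proj2 ?X ?X \<star> ?k = g \<cdot> h \<cdot> (proj2 ?X ?X \<star> ?k)"
    by (rule cancel [symmetric]) simp_all
  also note *
  also have "g \<cdot> h \<cdot> (proj1 ?X ?X \<star> ?k) = proj1 ?X ?X \<star> ?k"
    by (rule cancel) simp_all
  finally show "proj2 ?X ?X \<star> ?k = proj1 ?X ?X \<star> ?k" .
qed (use det_Arr [OF h] in simp)

text \<open>The middle swap brings matching factors together; since both unitors agree at the unit,
  multiplying the two resulting effects is \<open>\<star>\<close>.\<close>

lemma Cap_TensorO_pair:
  assumes "f \<in> Arr \<C>" "g \<in> Arr \<C>" "h \<in> Arr \<C>" "k \<in> Arr \<C>"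
    and "Dom \<C> g = Dom \<C> f" "Dom \<C> h = Dom \<C> f" "Dom \<C> k = Dom \<C> f"
    and "Cod \<C> f = X" "Cod \<C> g = Y" "Cod \<C> h = X" "Cod \<C> k = Y"
  shows "\<kappa> (X \<odot> Y) \<cdot> \<langle>\<langle>f, g\<rangle>, \<langle>h, k\<rangle>\<rangle> = (\<kappa> X \<cdot> \<langle>f, h\<rangle>) \<star> (\<kappa> Y \<cdot> \<langle>g, k\<rangle>)"
proof -
  have "X \<in> Obj \<C>" "Y \<in> Obj \<C>"
    using assms by auto
  then show ?thesis
    using assms by (simp add: Cap_Tensor LUnit_Unit weight_def)
qed

lemma cap_with_pair:
  assumes "F \<in> Arr \<C>" "Cod \<C> F = Y \<odot> X" "Y \<in> Obj \<C>" "X \<in> Obj \<C>"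
  shows "cap_with \<C> Y X F
    = ((proj1 Y X \<cdot> proj1 (Y \<odot> X) X) \<star> (\<kappa> X \<cdot> \<langle>proj2 Y X \<cdot> proj1 (Y \<odot> X) X, proj2 (Y \<odot> X) X\<rangle>)) \<cdot> (F \<otimes> \<i> X)"
proof -
  let ?p = "proj1 Y X \<cdot> proj1 (Y \<odot> X) X" and ?q = "\<kappa> X \<cdot> \<langle>proj2 Y X \<cdot> proj1 (Y \<odot> X) X, proj2 (Y \<odot> X) X\<rangle>"
  have "cap_with \<C> Y X F = (\<rho>\<^sub>u Y \<cdot> (\<i> Y \<otimes> \<kappa> X) \<cdot> \<alpha> Y X X) \<cdot> (F \<otimes> \<i> X)"
    using assms by (simp add: cap_with_def)
  also have "\<rho>\<^sub>u Y \<cdot> (\<i> Y \<otimes> \<kappa> X) \<cdot> \<alpha> Y X X = ?p \<star> ?q"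
    using assms by (simp add: Assoc_eq_pair weight_def del: pair_Comp)
  finally show ?thesis .
qed

end

section \<open>Faithfulness of bending outputs into inputs\<close>

context cancellative_caps
begin

text \<open>This is cancellativity with trivial remaining output: \<open>f\<close> is padded to
  \<open>\<langle>\<epsilon> Z, f\<rangle>\<close> to obtain the codomain
  \<open>\<I> \<odot> Y\<close>, and the padding is removed by the left unitor.\<close>

lemma Cap_cancel_effect:
  assumes fg: "f \<in> Arr \<C>" "g \<in> Arr \<C>" "Dom \<C> f = Z" "Dom \<C> g = Z" "Cod \<C> f = Y" "Cod \<C> g = Y"
    and eq: "\<kappa> Y \<cdot> \<langle>f \<cdot> proj1 Z Y, proj2 Z Y\<rangle> = \<kappa> Y \<cdot> \<langle>g \<cdot> proj1 Z Y, proj2 Z Y\<rangle>"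
  shows "f = g"
proof -
  have Obj: "Z \<in> Obj \<C>" "Y \<in> Obj \<C>"
    using fg by auto
  have *: "cap_with \<C> \<I> Y \<langle>\<epsilon> Z, f\<rangle> = \<kappa> Y \<cdot> \<langle>f \<cdot> proj1 Z Y, proj2 Z Y\<rangle>"
    if [simp]: "f \<in> Arr \<C>" "Dom \<C> f = Z" "Cod \<C> f = Y" for f
  proof -
    have "\<langle>\<epsilon> Z, f\<rangle> \<otimes> \<i> Y = \<langle>\<langle>\<epsilon> (Z \<odot> Y), f \<cdot> proj1 Z Y\<rangle>, proj2 Z Y\<rangle>"
      using Obj by (simp add: TensorA_eq_pair)
    then have "cap_with \<C> \<I> Y \<langle>\<epsilon> Z, f\<rangle> = \<rho>\<^sub>u \<I> \<cdot> \<langle>\<epsilon> (Z \<odot> Y), \<kappa> Y \<cdot> \<langle>f \<cdot> proj1 Z Y, proj2 Z Y\<rangle>\<rangle>"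
      using Obj by (simp add: cap_with_def)
    then show ?thesis
      using Obj by (simp flip: LUnit_Unit)
  qed
  have "\<langle>\<epsilon> Z, f\<rangle> = \<langle>\<epsilon> Z, g\<rangle>"
    by (rule Cap_cancel [of Y \<I> _ Z]) (use Obj fg eq * in \<open>simp_all add: hom_def\<close>)
  then have "\<lambda>\<^sub>u Y \<cdot> \<langle>\<epsilon> Z, f\<rangle> = \<lambda>\<^sub>u Y \<cdot> \<langle>\<epsilon> Z, g\<rangle>"
    by simp
  then show ?thesis
    using fg by simp
qed

end

section \<open>Finite products indexed by sets\<close>

locale indexed_family = cd_category \<C>
  for \<C> :: "('o, 'm, 'z) cdc_scheme" (structure) +
  fixes X :: "nat \<Rightarrow> 'o" and J :: "nat set"
  assumes index_Obj [simp]: "i \<in> J \<Longrightarrow> X i \<in> Obj \<C>" and finite_J: "finite J"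
begin

abbreviation TL :: "nat list \<Rightarrow> 'o" where "TL \<equiv> tensor_list \<C> X"
abbreviation TS :: "nat set \<Rightarrow> 'o" where "TS \<equiv> tensor_set \<C> X"

text \<open>The case distinction mirrors \<open>tensor_list\<close>; the domain \<open>W\<close> is
  an argument because an empty tuple has no component to supply it.\<close>

fun tuple :: "'o \<Rightarrow> (nat \<Rightarrow> 'm) \<Rightarrow> nat list \<Rightarrow> 'm" where
  "tuple W x [] = \<epsilon> W"
| "tuple W x [i] = x i"
| "tuple W x (i # j # js) = \<langle>x i, tuple W x (j # js)\<rangle>"

text \<open>Meaningful only for an index occurring in the list: lists of length at most one do not
  inspect it.\<close>

fun coord :: "nat list \<Rightarrow> nat \<Rightarrow> 'm" where
  "coord [] i = \<epsilon> \<I>"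
| "coord [j] i = \<i> (X j)"
| "coord (j # k # ks) i =
    (if i = j then proj1 (X j) (TL (k # ks)) else coord (k # ks) i \<cdot> proj2 (X j) (TL (k # ks)))"

definition det_family :: "'o \<Rightarrow> (nat \<Rightarrow> 'm) \<Rightarrow> nat list \<Rightarrow> bool" where
  "det_family W x js \<longleftrightarrow> W \<in> Obj \<C> \<and> set js \<subseteq> J \<and>
     (\<forall>i \<in> set js. det (x i) \<and> Dom \<C> (x i) = W \<and> Cod \<C> (x i) = X i)"

lemma TL_Obj [simp]: "set js \<subseteq> J \<Longrightarrow> TL js \<in> Obj \<C>"
  by (induction js rule: induct_list012) auto

lemma tuple_det:
  "det_family W x js \<Longrightarrow> det (tuple W x js) \<and> Dom \<C> (tuple W x js) = W \<and> Cod \<C> (tuple W x js) = TL js"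
  by (induction js rule: induct_list012) (auto simp: det_family_def det_Arr)

lemma tuple_Arr [simp]:
  assumes "det_family W x js"
  shows "det (tuple W x js)" "tuple W x js \<in> Arr \<C>" "Dom \<C> (tuple W x js) = W" "Cod \<C> (tuple W x js) = TL js"
  using tuple_det [OF assms] by (auto intro: det_Arr)

lemma det_family_Cons:
  "det_family W x (i # js) \<longleftrightarrow>
    i \<in> J \<and> det (x i) \<and> Dom \<C> (x i) = W \<and> Cod \<C> (x i) = X i \<and> det_family W x js"
  by (auto simp: det_family_def)

lemma det_family_subset: "\<lbrakk>det_family W x js; set ks \<subseteq> set js\<rbrakk> \<Longrightarrow> det_family W x ks"
  by (auto simp: det_family_def)

lemma tuple_cong:
  "(\<And>i. i \<in> set js \<Longrightarrow> x i = y i) \<Longrightarrow> tuple W x js = tuple W y js"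
  by (induction js rule: induct_list012) auto

lemma tuple_Comp:
  assumes "det_family W x js" "det h" "Cod \<C> h = W"
  shows "tuple W x js \<cdot> h = tuple (Dom \<C> h) (\<lambda>i. x i \<cdot> h) js"
  using assms(1)
proof (induction js rule: induct_list012)
  case (3 i j js)
  then show ?case
    using assms(2,3) det_Arr [of h] by (simp add: det_family_Cons det_Arr)
qed (use assms(2,3) det_Arr [of h] in \<open>auto simp: det_family_def\<close>)

lemma coord_det:
  "\<lbrakk>set js \<subseteq> J; i \<in> set js\<rbrakk> \<Longrightarrow> det (coord js i) \<and> Dom \<C> (coord js i) = TL js \<and> Cod \<C> (coord js i) = X i"
  by (induction js rule: induct_list012) (auto simp: det_Arr)

lemma coord_Arr [simp]:
  assumes "set js \<subseteq> J" "i \<in> set js"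
  shows "det (coord js i)" "coord js i \<in> Arr \<C>" "Dom \<C> (coord js i) = TL js" "Cod \<C> (coord js i) = X i"
  using coord_det [OF assms] by (auto intro: det_Arr)

lemma det_family_coord [simp]: "\<lbrakk>set js \<subseteq> J; set ks \<subseteq> set js\<rbrakk> \<Longrightarrow> det_family (TL js) (coord js) ks"
  by (auto simp: det_family_def)

lemma coord_tuple [simp]:
  "\<lbrakk>det_family W x js; i \<in> set js\<rbrakk> \<Longrightarrow> coord js i \<cdot> tuple W x js = x i"
proof (induction js rule: induct_list012)
  case (3 j k ks)
  have "set (k # ks) \<subseteq> J" "j \<in> J"
    using 3(3) by (auto simp: det_family_def)
  then show ?case
    using 3 coord_Arr [of "k # ks" i] by (auto simp: det_family_Cons det_Arr simp del: coord_Arr)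
qed (auto simp: det_family_def det_Arr)

text \<open>With \<open>coord_tuple\<close> this gives the universal property of a finite product
  among deterministic arrows. Distinctness matters because \<open>coord\<close> finds the first
  occurrence of an index.\<close>

lemma tuple_coord [simp]:
  "\<lbrakk>set js \<subseteq> J; distinct js\<rbrakk> \<Longrightarrow> tuple (TL js) (coord js) js = \<i> (TL js)"
proof (induction js rule: induct_list012)
  case (3 j k ks)
  have "tuple (TL (j # k # ks)) (coord (j # k # ks)) (k # ks)
      = tuple (TL (j # k # ks)) (\<lambda>i. coord (k # ks) i \<cdot> proj2 (X j) (TL (k # ks))) (k # ks)"
    using 3(4) by (intro tuple_cong) auto
  also have "\<dots> = tuple (TL (k # ks)) (coord (k # ks)) (k # ks) \<cdot> proj2 (X j) (TL (k # ks))"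
    using 3(3) tuple_Comp [of "TL (k # ks)" "coord (k # ks)" "k # ks" "proj2 (X j) (TL (k # ks))"] by simp
  also have "\<dots> = proj2 (X j) (TL (k # ks))"
    using 3 by simp
  finally have *: "tuple (TL (j # k # ks)) (coord (j # k # ks)) (k # ks) = proj2 (X j) (TL (k # ks))" .
  show ?case
    using 3 by (subst tuple.simps, subst *) simp
qed (auto simp: Discard_Unit)

lemma det_eq_tuple:
  assumes "det h" "Cod \<C> h = TL js" "set js \<subseteq> J" "distinct js"
  shows "h = tuple (Dom \<C> h) (\<lambda>i. coord js i \<cdot> h) js"
proof -
  have "h = tuple (TL js) (coord js) js \<cdot> h"
    using assms det_Arr by simp
  also have "\<dots> = tuple (Dom \<C> h) (\<lambda>i. coord js i \<cdot> h) js"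
    using assms by (intro tuple_Comp) auto
  finally show ?thesis .
qed

lemma tensor_cons_Arr [simp]:
  assumes "i \<in> J" "set js \<subseteq> J"
  shows "tensor_cons \<C> X i js \<in> Arr \<C>" "Dom \<C> (tensor_cons \<C> X i js) = X i \<odot> TL js"
    "Cod \<C> (tensor_cons \<C> X i js) = TL (i # js)"
  using assms by (cases js; simp add: tensor_cons_def)+

lemma tensor_cons_tuple [simp]:
  "det_family W x (i # js) \<Longrightarrow> tensor_cons \<C> X i js \<cdot> \<langle>x i, tuple W x js\<rangle> = tuple W x (i # js)"
  by (cases js) (auto simp: tensor_cons_def det_family_def det_Arr det_family_Cons[symmetric])

lemma iso_Id: "Y \<in> Obj \<C> \<Longrightarrow> iso \<C> (\<i> Y)"
  unfolding iso_def inverse_arrows_def hom_def by (intro exI [of _ "\<i> Y"]) simp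

lemma iso_tensor_cons: "\<lbrakk>i \<in> J; set js \<subseteq> J\<rbrakk> \<Longrightarrow> iso \<C> (tensor_cons \<C> X i js)"
  by (auto simp: tensor_cons_def intro: iso_Id)

lemma tensor_cons_inv:
  assumes "set (i # js) \<subseteq> J" "distinct (i # js)"
  shows "inv_arr \<C> (tensor_cons \<C> X i js)
    = \<langle>coord (i # js) i, tuple (TL (i # js)) (coord (i # js)) js\<rangle>"
proof (rule inv_arr_eqI_right)
  have [simp]: "det_family (TL (i # js)) (coord (i # js)) js" "det_family (TL (i # js)) (coord (i # js)) (i # js)"
    using assms by (auto intro!: det_family_coord simp del: tensor_list.simps)
  have c [simp]: "coord (i # js) i \<in> Arr \<C>" "Dom \<C> (coord (i # js) i) = TL (i # js)"
    "Cod \<C> (coord (i # js) i) = X i"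
    using assms by (auto intro!: coord_Arr simp del: coord.simps tensor_list.simps)
  show "iso \<C> (tensor_cons \<C> X i js)"
    using assms by (auto intro: iso_tensor_cons)
  show "tensor_cons \<C> X i js \<cdot> \<langle>coord (i # js) i, tuple (TL (i # js)) (coord (i # js)) js\<rangle>
      = \<i> (Cod \<C> (tensor_cons \<C> X i js))"
    using assms tuple_coord [of "i # js"] by simp
  show "\<langle>coord (i # js) i, tuple (TL (i # js)) (coord (i # js)) js\<rangle> \<in> Arr \<C>"
    by simp
  have "Cod \<C> \<langle>coord (i # js) i, tuple (TL (i # js)) (coord (i # js)) js\<rangle> = X i \<odot> TL js"
    by simp
  then show "Dom \<C> (tensor_cons \<C> X i js)
      = Cod \<C> \<langle>coord (i # js) i, tuple (TL (i # js)) (coord (i # js)) js\<rangle>"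
    using assms by (subst tensor_cons_Arr) auto
qed

text \<open>By induction the tail is already a pair of tuples. The head is put in front, and
  rebracketing and symmetry only rearrange nested pairs.\<close>

lemma unshuffle_eq_pair:
  "\<lbrakk>set js \<subseteq> J; distinct js\<rbrakk> \<Longrightarrow> unshuffle \<C> X P js
    = \<langle>tuple (TL js) (coord js) (filter P js), tuple (TL js) (coord js) (filter (\<lambda>j. \<not> P j) js)\<rangle>"
proof (induction js)
  case Nil
  then show ?case
    by (simp add: LUnit_inv Discard_Unit)
next
  case (Cons i js)
  let ?T = "TL (i # js)" and ?c = "coord (i # js)"
  let ?ls = "filter P js" and ?rs = "filter (\<lambda>j. \<not> P j) js"
  have sub [simp]: "set ?ls \<subseteq> J" "set ?rs \<subseteq> J"
    using Cons.prems by auto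
  have J [simp]: "i \<in> J" "set js \<subseteq> J" "i \<notin> set js" "distinct js"
    using Cons by auto
  have fam: "det_family ?T ?c (i # js)"
    by (intro det_family_coord) auto
  have [simp]: "?T \<in> Obj \<C>"
    by (intro TL_Obj) auto
  have fams [simp]: "det_family ?T ?c js" "det_family ?T ?c ?ls" "det_family ?T ?c ?rs"
      "det_family ?T ?c (i # ?ls)" "det_family ?T ?c (i # ?rs)"
    by (rule det_family_subset [OF fam]; auto)+
  have c [simp]: "det (?c i)" "?c i \<in> Arr \<C>" "Dom \<C> (?c i) = ?T" "Cod \<C> (?c i) = X i"
    using fam det_Arr by (auto simp: det_family_def)
  \<comment> \<open>Coordinates of the tail, read from the tail part of the whole product, are
    coordinates of the whole product.\<close>
  have restr: "tuple (TL js) (coord js) ks \<cdot> tuple ?T ?c js = tuple ?T ?c ks" if "set ks \<subseteq> set js" for ks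
  proof -
    have "tuple (TL js) (coord js) ks \<cdot> tuple ?T ?c js = tuple ?T (\<lambda>i. coord js i \<cdot> tuple ?T ?c js) ks"
      using that by (subst tuple_Comp) auto
    also have "\<dots> = tuple ?T ?c ks"
      using that by (intro tuple_cong coord_tuple) auto
    finally show ?thesis .
  qed
  have fjs [simp]: "det_family (TL js) (coord js) ?ls" "det_family (TL js) (coord js) ?rs"
    by auto
  have U: "unshuffle \<C> X P js = \<langle>tuple (TL js) (coord js) ?ls, tuple (TL js) (coord js) ?rs\<rangle>"
    using Cons by simp
  have step: "(\<i> (X i) \<otimes> unshuffle \<C> X P js) \<cdot> inv_arr \<C> (tensor_cons \<C> X i js)
      = \<langle>?c i, \<langle>tuple ?T ?c ?ls, tuple ?T ?c ?rs\<rangle>\<rangle>"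
    using tensor_cons_inv [of i js] by (simp add: U restr del: coord.simps tensor_list.simps)
  note [simp del] = coord.simps tensor_list.simps tuple.simps set_filter
  show ?case
  proof (cases "P i")
    case True
    then show ?thesis
      by (simp add: Let_def step)
  next
    case False
    then show ?thesis
      by (simp add: Let_def step)
  qed
qed

section \<open>Restriction of a product to a subset of its indices\<close>

definition restr :: "nat set \<Rightarrow> nat set \<Rightarrow> 'm" where
  "restr S T = tuple (TS S) (coord (sorted_list_of_set S)) (sorted_list_of_set T)"

lemma finite_index [simp]: "S \<subseteq> J \<Longrightarrow> finite S"
  using finite_J finite_subset by blast

lemma TS_Obj [simp]: "S \<subseteq> J \<Longrightarrow> TS S \<in> Obj \<C>"
  by (simp add: tensor_set_def)

lemma det_family_restr:
  assumes "S \<subseteq> J" "T \<subseteq> S"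
  shows "det_family (TS S) (coord (sorted_list_of_set S)) (sorted_list_of_set T)"
proof -
  have "T \<subseteq> J"
    using assms by auto
  then show ?thesis
    using assms unfolding tensor_set_def by (intro det_family_coord) auto
qed

lemma restr_Arr [simp]:
  assumes "S \<subseteq> J" "T \<subseteq> S"
  shows "det (restr S T)" "restr S T \<in> Arr \<C>" "Dom \<C> (restr S T) = TS S" "Cod \<C> (restr S T) = TS T"
  using det_family_restr [OF assms] by (auto simp: restr_def tensor_set_def)

lemma restr_self [simp]: "S \<subseteq> J \<Longrightarrow> restr S S = \<i> (TS S)"
  by (simp add: restr_def tensor_set_def)

lemma coord_restr:
  assumes "S \<subseteq> J" "T \<subseteq> S" "i \<in> T"
  shows "coord (sorted_list_of_set T) i \<cdot> restr S T = coord (sorted_list_of_set S) i"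
  unfolding restr_def
  using assms finite_index [of T] by (intro coord_tuple det_family_restr) auto

lemma restr_restr [simp]:
  assumes "S \<subseteq> J" "T \<subseteq> S" "U \<subseteq> T"
  shows "restr T U \<cdot> restr S T = restr S U"
proof -
  have "T \<subseteq> J" "U \<subseteq> J" using assms by auto
  then have "restr T U \<cdot> restr S T
      = tuple (TS S) (\<lambda>i. coord (sorted_list_of_set T) i \<cdot> restr S T) (sorted_list_of_set U)"
    unfolding restr_def [of T U] using assms by (subst tuple_Comp) (auto simp: det_family_restr)
  also have "\<dots> = restr S U"
    unfolding restr_def [of S U] using assms \<open>U \<subseteq> J\<close> by (intro tuple_cong coord_restr) auto
  finally show ?thesis .
qed

lemma split_set_eq_pair:
  assumes "S \<subseteq> J" "T \<subseteq> J" "S \<inter> T = {}"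
  shows "split_set \<C> X S T = \<langle>restr (S \<union> T) S, restr (S \<union> T) T\<rangle>"
proof -
  \<comment> \<open>Filtering keeps a list sorted and distinct, so the filtered lists are the sorted
    enumerations of \<open>S\<close> and \<open>T\<close>.\<close>
  have "filter (\<lambda>i. i \<in> S) (sorted_list_of_set (S \<union> T)) = sorted_list_of_set S"
    "filter (\<lambda>i. i \<notin> S) (sorted_list_of_set (S \<union> T)) = sorted_list_of_set T"
    using assms by (auto intro!: sorted_distinct_set_unique sorted_wrt_filter)
  then show ?thesis
    using assms by (simp add: split_set_def unshuffle_eq_pair restr_def tensor_set_def)
qed

lemma split_set_inverse:
  assumes "S \<subseteq> J" "T \<subseteq> J" "S \<inter> T = {}"
  obtains g where "det g" "Dom \<C> g = TS S \<odot> TS T" "Cod \<C> g = TS (S \<union> T)"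
    "g \<cdot> \<langle>restr (S \<union> T) S, restr (S \<union> T) T\<rangle> = \<i> (TS (S \<union> T))"
    "\<langle>restr (S \<union> T) S, restr (S \<union> T) T\<rangle> \<cdot> g = \<i> (TS S \<odot> TS T)"
proof -
  let ?U = "S \<union> T" and ?l = sorted_list_of_set
  let ?W = "TS S \<odot> TS T"
  \<comment> \<open>The inverse is written down by coordinates: each index is read from the factor
    that contains it.\<close>
  let ?x = "\<lambda>i. if i \<in> S then coord (?l S) i \<cdot> proj1 (TS S) (TS T) else coord (?l T) i \<cdot> proj2 (TS S) (TS T)"
  let ?g = "tuple ?W ?x (?l ?U)"
  have U [simp]: "?U \<subseteq> J" "S \<subseteq> J" "T \<subseteq> J" "finite S" "finite T"
    using assms by auto
  have c: "det (coord (?l R) i)" "coord (?l R) i \<in> Arr \<C>" "Dom \<C> (coord (?l R) i) = TS R"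
      "Cod \<C> (coord (?l R) i) = X i" if "R \<subseteq> J" "i \<in> R" for R i
    using that finite_index [of R] by (simp_all add: tensor_set_def)
  note [simp del] = coord_Arr
  note c [simp]
  have fam: "det_family ?W ?x (?l ?U)"
    using assms by (auto simp: det_family_def)
  have g [simp]: "det ?g" "?g \<in> Arr \<C>" "Dom \<C> ?g = ?W" "Cod \<C> ?g = TS ?U"
    using fam by (simp_all add: tensor_set_def)
  have "?g \<cdot> \<langle>restr ?U S, restr ?U T\<rangle> = tuple (TS ?U) (\<lambda>i. ?x i \<cdot> \<langle>restr ?U S, restr ?U T\<rangle>) (?l ?U)"
    using tuple_Comp [OF fam, of "\<langle>restr ?U S, restr ?U T\<rangle>"] by simp
  also have "\<dots> = tuple (TS ?U) (coord (?l ?U)) (?l ?U)"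
    by (intro tuple_cong) (auto simp: coord_restr)
  also have "\<dots> = \<i> (TS ?U)"
    by (simp add: tensor_set_def)
  finally have 1: "?g \<cdot> \<langle>restr ?U S, restr ?U T\<rangle> = \<i> (TS ?U)" .
  have *: "coord (?l ?U) i \<cdot> ?g = ?x i" if "i \<in> ?U" for i
    using that by (intro coord_tuple [OF fam]) simp
  \<comment> \<open>A deterministic arrow into a product is the tuple of its coordinates, so it
    suffices to compare coordinates.\<close>
  have restr_g: "restr ?U R \<cdot> ?g = h"
    if [simp]: "R \<subseteq> ?U" "det h" "Dom \<C> h = ?W" "Cod \<C> h = TS R" and h: "\<And>i. i \<in> R \<Longrightarrow> ?x i = coord (?l R) i \<cdot> h"
    for R h
  proof -
    have [simp]: "R \<subseteq> J" using U(1) that(1) by blast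
    have eq: "coord (?l ?U) i \<cdot> ?g = coord (?l R) i \<cdot> h" if "i \<in> R" for i
      by (rule trans [OF * h]) (use that subsetD [OF \<open>R \<subseteq> ?U\<close>] in auto)
    have "restr ?U R \<cdot> ?g = tuple ?W (\<lambda>i. coord (?l ?U) i \<cdot> ?g) (?l R)"
      unfolding restr_def by (subst tuple_Comp) (auto simp: det_family_restr)
    also have "\<dots> = tuple ?W (\<lambda>i. coord (?l R) i \<cdot> h) (?l R)"
      using eq by (intro tuple_cong) simp
    also have "\<dots> = h"
      using det_eq_tuple [of h "?l R"] by (simp add: tensor_set_def)
    finally show ?thesis .
  qed
  have "restr ?U S \<cdot> ?g = proj1 (TS S) (TS T)" "restr ?U T \<cdot> ?g = proj2 (TS S) (TS T)"
    using assms by (intro restr_g; force)+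
  then have "\<langle>restr ?U S, restr ?U T\<rangle> \<cdot> ?g = \<i> ?W"
    by simp
  with 1 show thesis
    by (intro that [of ?g]) simp_all
qed

end

section \<open>Conditional independence as a factorisation of densities\<close>

locale indexed_state = effect_conditioning \<C> + indexed_family \<C> X J
  for \<C> :: "('o, 'm, 'z) ecc_scheme" (structure) and X :: "nat \<Rightarrow> 'o" and J :: "nat set" +
  fixes n :: nat and \<omega> :: 'm
  assumes J_eq: "J = {1..n}" and state_hom: "\<omega> \<in> hom \<C> \<I> (TS J)"
begin

lemma state_Arr [simp]: "\<omega> \<in> Arr \<C>" "Dom \<C> \<omega> = \<I>" "Cod \<C> \<omega> = TS J"
  using homD [OF state_hom] by simp_all

text \<open>Splitting off the complement and discarding it is the first projection of a pair of
  restrictions.\<close>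

lemma marginal_eq:
  assumes "S \<subseteq> J"
  shows "marginal \<C> X n \<omega> S = restr J S \<cdot> \<omega>"
proof -
  have J: "S \<union> J = J"
    using assms by auto
  have "marginal \<C> X n \<omega> S = proj1 (TS S) (TS (J - S)) \<cdot> \<langle>restr J S, restr J (J - S)\<rangle> \<cdot> \<omega>"
    using assms split_set_eq_pair [of S "J - S"]
    unfolding marginal_def J_eq [symmetric] by (simp add: proj1_def J del: TensorA_pair)
  also have "\<dots> = restr J S \<cdot> \<omega>"
    using assms by (intro Comp_cong_right) simp_all
  finally show ?thesis .
qed

text \<open>Here \<open>raw_cond S T : TS T \<rightarrow> TS S\<close> is the conditional before normalisation. The effect
  \<open>density T R\<close> is the density of the marginal on \<open>T\<close>, and \<open>graph T S f R\<close> that of an arrow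
  \<open>f : TS T \<rightarrow> TS S\<close> whose output is bent into an input by a cap. Both are read as effects on
  \<open>TS R\<close> for a larger index set \<open>R\<close>, so that they can be multiplied.\<close>

definition with_state :: "nat set \<Rightarrow> 'm" where
  "with_state R = \<langle>\<omega> \<cdot> \<epsilon> (TS R), \<i> (TS R)\<rangle>"

definition raw_cond :: "nat set \<Rightarrow> nat set \<Rightarrow> 'm" where
  "raw_cond S T = cap_with \<C> (TS S) (TS T) (split_set \<C> X S T \<cdot> marginal \<C> X n \<omega> (S \<union> T))
     \<cdot> inv_arr \<C> (\<lambda>\<^sub>u (TS T))"

text \<open>The whole of \<open>TS J\<close> is retained, not just the factors in \<open>T\<close>,
  so that for fixed \<open>R\<close> all these effects live on one object and can be
  multiplied.\<close>

definition agree :: "nat set \<Rightarrow> nat set \<Rightarrow> 'm" where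
  "agree T R = \<kappa> (TS T) \<cdot> \<langle>restr J T \<cdot> proj1 (TS J) (TS R), restr R T \<cdot> proj2 (TS J) (TS R)\<rangle>"

definition density :: "nat set \<Rightarrow> nat set \<Rightarrow> 'm" where
  "density T R = agree T R \<cdot> with_state R"

definition graph :: "nat set \<Rightarrow> nat set \<Rightarrow> 'm \<Rightarrow> nat set \<Rightarrow> 'm" where
  "graph T S f R = \<kappa> (TS S) \<cdot> \<langle>f \<cdot> restr R T, restr R S\<rangle>"

lemma with_state_Arr [simp]:
  assumes "R \<subseteq> J"
  shows "with_state R \<in> Arr \<C>" "Dom \<C> (with_state R) = TS R" "Cod \<C> (with_state R) = TS J \<odot> TS R"
  using assms by (simp_all add: with_state_def)

lemma agree_Arr [simp]:
  assumes "R \<subseteq> J" "T \<subseteq> R"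
  shows "agree T R \<in> Arr \<C>" "Dom \<C> (agree T R) = TS J \<odot> TS R" "Cod \<C> (agree T R) = \<I>"
proof -
  have "T \<subseteq> J" using assms by auto
  then show "agree T R \<in> Arr \<C>" "Dom \<C> (agree T R) = TS J \<odot> TS R" "Cod \<C> (agree T R) = \<I>"
    using assms by (simp_all add: agree_def)
qed

lemma density_Arr [simp]:
  assumes "R \<subseteq> J" "T \<subseteq> R"
  shows "density T R \<in> Arr \<C>" "Dom \<C> (density T R) = TS R" "Cod \<C> (density T R) = \<I>"
  using assms by (simp_all add: density_def)

lemma graph_Arr [simp]:
  assumes "f \<in> Arr \<C>" "Dom \<C> f = TS T" "Cod \<C> f = TS S" "S \<subseteq> R" "T \<subseteq> R" "R \<subseteq> J"
  shows "graph T S f R \<in> Arr \<C>" "Dom \<C> (graph T S f R) = TS R" "Cod \<C> (graph T S f R) = \<I>"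
proof -
  have "S \<subseteq> J" "T \<subseteq> J" using assms by auto
  then show "graph T S f R \<in> Arr \<C>" "Dom \<C> (graph T S f R) = TS R" "Cod \<C> (graph T S f R) = \<I>"
    using assms by (simp_all add: graph_def)
qed

text \<open>All use of the state is isolated in \<open>with_state\<close>; what follows it is built
  from restrictions and a cap, so the calculus of pairs and weights applies there.\<close>

lemma raw_cond_eq:
  assumes S: "S \<subseteq> J" and T: "T \<subseteq> J" and "S \<inter> T = {}"
  shows "raw_cond S T = ((restr J S \<cdot> proj1 (TS J) (TS T)) \<star> agree T T) \<cdot> with_state T"
proof -
  let ?S = "TS S" and ?T = "TS T" and ?G = "\<langle>restr J S, restr J T\<rangle>"
  note [simp] = S T
  have F: "split_set \<C> X S T \<cdot> marginal \<C> X n \<omega> (S \<union> T) = ?G \<cdot> \<omega>"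
    using assms by (simp add: marginal_eq split_set_eq_pair flip: Comp_assoc')
  let ?V = "(proj1 ?S ?T \<cdot> proj1 (?S \<odot> ?T) ?T)
    \<star> (\<kappa> ?T \<cdot> \<langle>proj2 ?S ?T \<cdot> proj1 (?S \<odot> ?T) ?T, proj2 (?S \<odot> ?T) ?T\<rangle>)"
  have "raw_cond S T = ?V \<cdot> ((?G \<cdot> \<omega>) \<otimes> \<i> ?T) \<cdot> \<langle>\<epsilon> ?T, \<i> ?T\<rangle>"
    unfolding raw_cond_def F by (subst cap_with_pair) (simp_all add: LUnit_inv)
  also have "((?G \<cdot> \<omega>) \<otimes> \<i> ?T) \<cdot> \<langle>\<epsilon> ?T, \<i> ?T\<rangle> = (?G \<otimes> \<i> ?T) \<cdot> with_state T"
    by (simp add: with_state_def)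
  also have "?V \<cdot> (?G \<otimes> \<i> ?T) \<cdot> with_state T = (?V \<cdot> (?G \<otimes> \<i> ?T)) \<cdot> with_state T"
    by (intro Comp_assoc' [symmetric]) simp_all
  also have "?V \<cdot> (?G \<otimes> \<i> ?T) = (restr J S \<cdot> proj1 (TS J) ?T) \<star> agree T T"
    by (subst weight_Comp) (simp_all add: TensorA_eq_pair agree_def)
  finally show ?thesis .
qed

lemma raw_cond_Arr [simp]:
  assumes "S \<subseteq> J" "T \<subseteq> J" "S \<inter> T = {}"
  shows "raw_cond S T \<in> Arr \<C>" "Dom \<C> (raw_cond S T) = TS T" "Cod \<C> (raw_cond S T) = TS S"
  using assms by (simp_all add: raw_cond_eq)

text \<open>The definition normalises before removing the unit factor from the input;
  \<open>Norm_LUnit_inv\<close> exchanges the two.\<close>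

lemma cond_on_eq_Norm:
  assumes "S \<subseteq> J" "T \<subseteq> J" "S \<inter> T = {}"
  shows "cond_on \<C> X n \<omega> S T = Norm \<C> (raw_cond S T)"
  unfolding cond_on_def state_conditional_def conditional_def raw_cond_def
  using assms by (intro Norm_LUnit_inv) (simp_all add: cap_with_def marginal_eq split_set_eq_pair)

lemma with_state_restr:
  "\<lbrakk>R \<subseteq> J; T \<subseteq> R; T \<subseteq> J\<rbrakk> \<Longrightarrow> with_state T \<cdot> restr R T = (\<i> (TS J) \<otimes> restr R T) \<cdot> with_state R"
  by (simp add: with_state_def)

lemma pair_with_state:
  assumes "R \<subseteq> J" "f \<in> Arr \<C>" "g \<in> Arr \<C>" "Dom \<C> f = TS J \<odot> TS R" "Dom \<C> g = TS R"
  shows "\<langle>f \<cdot> with_state R, g\<rangle> = \<langle>f, g \<cdot> proj2 (TS J) (TS R)\<rangle> \<cdot> with_state R"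
proof -
  let ?J = "TS J" and ?R = "TS R"
  \<comment> \<open>\<open>with_state R\<close> contains the state and need not be deterministic, so
    only the input factor \<open>TS R\<close> is copied, not the state.\<close>
  let ?D = "\<alpha>' ?J ?R ?R \<cdot> (\<i> ?J \<otimes> \<Delta> ?R)"
  have "?D = \<langle>\<i> (?J \<odot> ?R), proj2 ?J ?R\<rangle>"
    using assms by (simp add: TensorA_eq_pair det_Copy_Comp)
  then have "\<langle>f, g \<cdot> proj2 ?J ?R\<rangle> \<cdot> with_state R = (f \<otimes> g) \<cdot> ?D \<cdot> with_state R"
    using assms by (simp flip: Comp_assoc')
  also have "?D \<cdot> with_state R = \<langle>with_state R, \<i> ?R\<rangle>"
    using assms by (simp add: with_state_def Copy_eq_pair)
  finally show ?thesis
    using assms by simp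
qed

lemma agree_restr:
  assumes "T \<subseteq> R" "R \<subseteq> R'" "R' \<subseteq> J"
  shows "agree T R \<cdot> (\<i> (TS J) \<otimes> restr R' R) = agree T R'"
proof -
  have "R \<subseteq> J" "T \<subseteq> J" "T \<subseteq> R'" using assms by auto
  then show ?thesis
    using assms by (simp add: agree_def TensorA_eq_pair flip: Comp_assoc' [of _ "restr R' R" "restr R T"])
qed

lemma density_restr [simp]:
  assumes "T \<subseteq> R" "R \<subseteq> R'" "R' \<subseteq> J"
  shows "density T R \<cdot> restr R' R = density T R'"
proof -
  have "R \<subseteq> J" "T \<subseteq> J" "T \<subseteq> R'" using assms by auto
  then show ?thesis
    using assms by (simp add: density_def with_state_restr Comp_cong_right [OF agree_restr])
qed

lemma graph_restr [simp]:
  assumes "f \<in> Arr \<C>" "Dom \<C> f = TS T" "Cod \<C> f = TS S" "S \<subseteq> R" "T \<subseteq> R" "R \<subseteq> R'" "R' \<subseteq> J"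
  shows "graph T S f R \<cdot> restr R' R = graph T S f R'"
proof -
  have "R \<subseteq> J" "T \<subseteq> J" "S \<subseteq> J" using assms by auto
  then show ?thesis
    using assms by (simp add: graph_def)
qed

text \<open>\<open>TS (S \<union> T)\<close> is in general only isomorphic to
  \<open>TS S \<odot> TS T\<close>; the isomorphism is deterministic, so \<open>Cap_iso\<close>
  transports the cap.\<close>

lemma Cap_split:
  assumes "S \<subseteq> J" "T \<subseteq> J" "S \<inter> T = {}"
    and "x \<in> Arr \<C>" "y \<in> Arr \<C>" "Dom \<C> y = Dom \<C> x" "Cod \<C> x = TS (S \<union> T)" "Cod \<C> y = TS (S \<union> T)"
  shows "\<kappa> (TS (S \<union> T)) \<cdot> \<langle>x, y\<rangle> = \<kappa> (TS S \<odot> TS T)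
    \<cdot> \<langle>\<langle>restr (S \<union> T) S, restr (S \<union> T) T\<rangle> \<cdot> x, \<langle>restr (S \<union> T) S, restr (S \<union> T) T\<rangle> \<cdot> y\<rangle>"
proof -
  let ?h = "\<langle>restr (S \<union> T) S, restr (S \<union> T) T\<rangle>"
  obtain g where "det g" "Dom \<C> g = TS S \<odot> TS T" "g \<cdot> ?h = \<i> (TS (S \<union> T))"
    using split_set_inverse [OF assms(1-3)] by metis
  then have "\<kappa> (TS (S \<union> T)) = \<kappa> (TS S \<odot> TS T) \<cdot> (?h \<otimes> ?h)"
    using Cap_iso [of ?h g] assms det_Arr [of g] by simp
  then show ?thesis
    using assms by simp
qed

lemma agree_Un:
  assumes "R \<subseteq> J" "S \<union> T \<subseteq> R" "S \<inter> T = {}"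
  shows "agree (S \<union> T) R = agree S R \<star> agree T R"
proof -
  have J: "S \<subseteq> J" "T \<subseteq> J" using assms by auto
  have r: "restr (S \<union> T) Q \<cdot> restr P (S \<union> T) \<cdot> h = restr P Q \<cdot> h"
    if "Q \<subseteq> S \<union> T" "S \<union> T \<subseteq> P" "P \<subseteq> J" "h \<in> Arr \<C>" "Cod \<C> h = TS P" for P Q h
  proof -
    have "Q \<subseteq> J" "S \<union> T \<subseteq> J" using that by auto
    then show ?thesis
      using that by (intro Comp_cong_right) auto
  qed
  show ?thesis
    using assms J unfolding agree_def
    by (subst Cap_split) (auto simp: r Cap_TensorO_pair)
qed

text \<open>Which factors are outputs and which are inputs is invisible in the density.\<close>

lemma graph_raw_cond:
  assumes "R \<subseteq> J" "S \<union> T \<subseteq> R" "S \<inter> T = {}"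
  shows "graph T S (raw_cond S T) R = density (S \<union> T) R"
proof -
  have J [simp]: "S \<subseteq> J" "T \<subseteq> J" "R \<subseteq> J" and [simp]: "S \<subseteq> R" "T \<subseteq> R"
    using assms by auto
  let ?p = "proj1 (TS J) (TS R)" and ?q = "proj2 (TS J) (TS R)"
  let ?V = "(restr J S \<cdot> proj1 (TS J) (TS T)) \<star> agree T T"
  have "raw_cond S T \<cdot> restr R T = ?V \<cdot> (\<i> (TS J) \<otimes> restr R T) \<cdot> with_state R"
    using assms by (simp add: raw_cond_eq with_state_restr)
  also have "\<dots> = (?V \<cdot> (\<i> (TS J) \<otimes> restr R T)) \<cdot> with_state R"
    by (intro Comp_assoc' [symmetric]) simp_all
  also have "?V \<cdot> (\<i> (TS J) \<otimes> restr R T) = (restr J S \<cdot> ?p) \<star> agree T R"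
  proof -
    have "(restr J S \<cdot> proj1 (TS J) (TS T)) \<cdot> (\<i> (TS J) \<otimes> restr R T) = restr J S \<cdot> ?p"
      by (simp add: TensorA_eq_pair [of _ "restr R T"])
    then show ?thesis
      by (subst weight_Comp) (simp_all add: agree_restr del: Comp_assoc')
  qed
  finally have "\<langle>raw_cond S T \<cdot> restr R T, restr R S\<rangle>
      = \<langle>(restr J S \<cdot> ?p) \<star> agree T R, restr R S \<cdot> ?q\<rangle> \<cdot> with_state R"
    by (simp add: pair_with_state)
  also have "\<langle>(restr J S \<cdot> ?p) \<star> agree T R, restr R S \<cdot> ?q\<rangle> = \<langle>restr J S \<cdot> ?p, restr R S \<cdot> ?q\<rangle> \<star> agree T R"
    by (rule pair_weight_left) simp_all
  finally have "graph T S (raw_cond S T) R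
      = (\<kappa> (TS S) \<cdot> (\<langle>restr J S \<cdot> ?p, restr R S \<cdot> ?q\<rangle> \<star> agree T R)) \<cdot> with_state R"
    by (simp add: graph_def)
  also have "\<kappa> (TS S) \<cdot> (\<langle>restr J S \<cdot> ?p, restr R S \<cdot> ?q\<rangle> \<star> agree T R) = agree (S \<union> T) R"
    using assms by (simp add: Comp_weight agree_Un agree_def [of S])
  finally show ?thesis
    by (simp add: density_def)
qed

text \<open>The mass of an unnormalised conditional is the marginal density of what is conditioned
  on; this is the weight that normalisation removes.\<close>

lemma Discard_raw_cond:
  assumes "S \<subseteq> J" "T \<subseteq> J" "S \<inter> T = {}"
  shows "\<epsilon> (TS S) \<cdot> raw_cond S T = density T T"
proof -
  let ?V = "(restr J S \<cdot> proj1 (TS J) (TS T)) \<star> agree T T"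
  have "\<epsilon> (TS S) \<cdot> raw_cond S T = (\<epsilon> (TS S) \<cdot> ?V) \<cdot> with_state T"
    using assms by (simp add: raw_cond_eq)
  also have "\<epsilon> (TS S) \<cdot> ?V = agree T T"
    using assms by (simp add: Comp_weight)
  finally show ?thesis
    by (simp add: density_def)
qed

lemma restr_raw_cond:
  assumes "S \<subseteq> J" "T \<subseteq> J" "S \<inter> T = {}" "S' \<subseteq> S"
  shows "restr S S' \<cdot> raw_cond S T = raw_cond S' T"
proof -
  have S': "S' \<subseteq> J" "S' \<inter> T = {}" using assms by auto
  let ?V = "(restr J S \<cdot> proj1 (TS J) (TS T)) \<star> agree T T"
  have "restr S S' \<cdot> raw_cond S T = (restr S S' \<cdot> ?V) \<cdot> with_state T"
    using assms S' by (simp add: raw_cond_eq)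
  also have "restr S S' \<cdot> ?V = (restr J S' \<cdot> proj1 (TS J) (TS T)) \<star> agree T T"
    using assms S' by (simp add: Comp_weight Comp_cong_right [OF restr_restr])
  finally show ?thesis
    using assms S' by (simp add: raw_cond_eq)
qed

lemma graph_weight:
  assumes "f \<in> Arr \<C>" "Dom \<C> f = TS T" "Cod \<C> f = TS S" "e \<in> Arr \<C>" "Dom \<C> e = TS T" "Cod \<C> e = \<I>"
    and "S \<subseteq> R" "T \<subseteq> R" "R \<subseteq> J"
  shows "graph T S (f \<star> e) R = graph T S f R \<star> (e \<cdot> restr R T)"
proof -
  have "S \<subseteq> J" "T \<subseteq> J" using assms by auto
  then show ?thesis
    using assms by (simp add: graph_def weight_Comp pair_weight_left Comp_weight)
qed

text \<open>The converse direction is where cancellativity of the caps enters.\<close>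

lemma split_eq_pair_iff:
  assumes J: "A \<subseteq> J" "B \<subseteq> J" "C \<subseteq> J" and disj: "A \<inter> B = {}" "A \<inter> C = {}" "B \<inter> C = {}"
    and F: "F \<in> Arr \<C>" "Dom \<C> F = TS C" "Cod \<C> F = TS (A \<union> B)"
    and f: "f \<in> Arr \<C>" "Dom \<C> f = TS C" "Cod \<C> f = TS A"
    and g: "g \<in> Arr \<C>" "Dom \<C> g = TS C" "Cod \<C> g = TS B"
  shows "split_set \<C> X A B \<cdot> F = \<langle>f, g\<rangle> \<longleftrightarrow>
    graph C (A \<union> B) F (A \<union> B \<union> C) = graph C A f (A \<union> B \<union> C) \<star> graph C B g (A \<union> B \<union> C)"
proof -
  let ?U = "A \<union> B" and ?R = "A \<union> B \<union> C"
  have C_U: "C \<union> ?U = ?R" "C \<inter> ?U = {}"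
    using disj by auto
  note [simp] = J F f g
  let ?h = "\<langle>restr ?U A, restr ?U B\<rangle>"
  have h: "split_set \<C> X A B = ?h"
    using disj by (intro split_set_eq_pair) simp_all
  have R [simp]: "A \<subseteq> ?R" "B \<subseteq> ?R" "C \<subseteq> ?R" "?U \<subseteq> ?R"
    by auto
  have fwd: "graph C ?U F ?R = graph C A f ?R \<star> graph C B g ?R"
    if [simp]: "F \<in> Arr \<C>" "Dom \<C> F = TS C" "Cod \<C> F = TS ?U" and hF: "?h \<cdot> F = \<langle>f, g\<rangle>" for F
  proof -
    have "?h \<cdot> F \<cdot> restr ?R C = \<langle>f \<cdot> restr ?R C, g \<cdot> restr ?R C\<rangle>"
      by (subst Comp_cong_right [OF hF]) simp_all
    moreover have "?h \<cdot> restr ?R ?U = \<langle>restr ?R A, restr ?R B\<rangle>"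
      by simp
    ultimately show ?thesis
      using disj Cap_split [of A B "F \<cdot> restr ?R C" "restr ?R ?U"]
      by (simp add: graph_def Cap_TensorO_pair del: pair_Comp)
  qed
  moreover have "?h \<cdot> F = \<langle>f, g\<rangle>" if eq: "graph C ?U F ?R = graph C A f ?R \<star> graph C B g ?R"
  proof -
    obtain k where k: "det k" "Dom \<C> k = TS A \<odot> TS B" "Cod \<C> k = TS ?U" "?h \<cdot> k = \<i> (TS A \<odot> TS B)"
      using split_set_inverse [of A B] disj J by metis
    note [simp] = det_Arr [OF k(1)] k(2,3)
    let ?s = "\<langle>restr ?R C, restr ?R ?U\<rangle>"
    obtain l where l: "det l" "Dom \<C> l = TS C \<odot> TS ?U" "Cod \<C> l = TS ?R" "?s \<cdot> l = \<i> (TS C \<odot> TS ?U)"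
      using split_set_inverse [of C ?U] C_U J by (metis Un_subset_iff)
    note [simp] = det_Arr [OF l(1)] l(2,3)
    \<comment> \<open>The arrow that the factorisation ought to produce. It satisfies the pair
      equation, so by \<open>fwd\<close> it has the same graph as \<open>F\<close>.\<close>
    let ?F = "k \<cdot> \<langle>f, g\<rangle>"
    have hF: "?h \<cdot> ?F = \<langle>f, g\<rangle>"
      by (subst Comp_cong_right [OF k(4)]) simp_all
    let ?E = "\<lambda>F. \<kappa> (TS ?U) \<cdot> \<langle>F \<cdot> proj1 (TS C) (TS ?U), proj2 (TS C) (TS ?U)\<rangle>"
    \<comment> \<open>The inverse \<open>l\<close> of the splitting into \<open>C\<close> and
      \<open>A \<union> B\<close> turns a graph into the form required by
      \<open>Cap_cancel_effect\<close>.\<close>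
    have E: "?E F = graph C ?U F ?R \<cdot> l" if [simp]: "F \<in> Arr \<C>" "Dom \<C> F = TS C" "Cod \<C> F = TS ?U" for F
    proof -
      have "graph C ?U F ?R \<cdot> l = ?E F \<cdot> (?s \<cdot> l)"
        using l(1) by (simp add: graph_def del: l(4))
      then show ?thesis
        using l(4) by simp
    qed
    have "graph C ?U ?F ?R = graph C ?U F ?R"
      using fwd [of ?F] hF eq by simp
    then have "?E ?F = ?E F"
      using E [of F] E [of ?F] by simp
    then have "?F = F"
      by (intro Cap_cancel_effect [of ?F F "TS C" "TS ?U"]) simp_all
    then show ?thesis
      using hF by simp
  qed
  ultimately show ?thesis
    using h by auto
qed

section \<open>Normalised conditionals, the chain rule and factorisation\<close>

abbreviation "cond \<equiv> cond_on \<C> X n \<omega>"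

lemma cond_Arr [simp]:
  assumes "S \<subseteq> J" "T \<subseteq> J" "S \<inter> T = {}"
  shows "cond S T \<in> Arr \<C>" "Dom \<C> (cond S T) = TS T" "Cod \<C> (cond S T) = TS S"
  using assms by (simp_all add: cond_on_eq_Norm)

lemma partial_channel_cond: "\<lbrakk>S \<subseteq> J; T \<subseteq> J; S \<inter> T = {}\<rbrakk> \<Longrightarrow> partial_channel \<C> (cond S T)"
  by (simp add: cond_on_eq_Norm Norm_partial_channel)

lemma raw_cond_eq_weight:
  assumes "S \<subseteq> J" "T \<subseteq> J" "S \<inter> T = {}"
  shows "raw_cond S T = cond S T \<star> density T T"
  using assms Norm_weight [of "raw_cond S T"] Discard_raw_cond [OF assms] by (simp add: cond_on_eq_Norm)

text \<open>The chain rule w(s,t) = p(s|t) w(t): weight the normalised conditional by the mass of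
  the raw one and bend its output.\<close>

lemma density_Un:
  assumes "R \<subseteq> J" "S \<union> T \<subseteq> R" "S \<inter> T = {}"
  shows "density (S \<union> T) R = graph T S (cond S T) R \<star> density T R"
proof -
  have "S \<subseteq> J" "T \<subseteq> J" "S \<subseteq> R" "T \<subseteq> R" using assms by auto
  then show ?thesis
    using assms by (simp add: raw_cond_eq_weight graph_weight flip: graph_raw_cond)
qed

lemma cond_indep_iff_pair:
  assumes "A \<subseteq> J" "B \<subseteq> J" "C \<subseteq> J" "A \<inter> B = {}" "A \<inter> C = {}" "B \<inter> C = {}"
  shows "cond_indep \<C> X n \<omega> A B C \<longleftrightarrow> split_set \<C> X A B \<cdot> cond (A \<union> B) C = \<langle>cond A C, cond B C\<rangle>"
  using assms by (simp add: cond_indep_def pair_def)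

text \<open>The partial channel \<open>p\<close> is a parameter and not fixed to be
  \<open>cond A C\<close>; weak union relies on this freedom, as its witness ignores part of the
  input.\<close>

definition factorises :: "nat set \<Rightarrow> nat set \<Rightarrow> nat set \<Rightarrow> 'm \<Rightarrow> bool" where
  "factorises A B C p \<longleftrightarrow> partial_channel \<C> p \<and> Dom \<C> p = TS C \<and> Cod \<C> p = TS A \<and>
     density (A \<union> B \<union> C) (A \<union> B \<union> C) = graph C A p (A \<union> B \<union> C) \<star> density (B \<union> C) (A \<union> B \<union> C)"

lemma factorises_iff:
  assumes J: "A \<subseteq> J" "B \<subseteq> J" "C \<subseteq> J" and disj: "A \<inter> B = {}" "A \<inter> C = {}" "B \<inter> C = {}"
  shows "factorises A B C p \<longleftrightarrow> partial_channel \<C> p \<and> Dom \<C> p = TS C \<and> Cod \<C> p = TS A \<and>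
    split_set \<C> X A B \<cdot> raw_cond (A \<union> B) C = \<langle>p, raw_cond B C\<rangle>"
proof (cases "partial_channel \<C> p \<and> Dom \<C> p = TS C \<and> Cod \<C> p = TS A")
  case True
  then have [simp]: "p \<in> Arr \<C>" "Dom \<C> p = TS C" "Cod \<C> p = TS A"
    by (simp_all add: partial_channel_def)
  have "(A \<union> B) \<inter> C = {}" "B \<union> C \<subseteq> A \<union> B \<union> C"
    using disj by auto
  then have "split_set \<C> X A B \<cdot> raw_cond (A \<union> B) C = \<langle>p, raw_cond B C\<rangle> \<longleftrightarrow>
      density (A \<union> B \<union> C) (A \<union> B \<union> C) = graph C A p (A \<union> B \<union> C) \<star> density (B \<union> C) (A \<union> B \<union> C)"
    using J disj split_eq_pair_iff [of A B C "raw_cond (A \<union> B) C" p "raw_cond B C"]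
    by (simp add: graph_raw_cond)
  then show ?thesis
    by (simp add: factorises_def)
qed (auto simp: factorises_def)

text \<open>From independence to a factorisation, multiply by the density on \<open>C\<close>.
  Conversely, normalise the factorisation; \<open>p\<close> may differ from \<open>cond A C\<close>,
  but only by a weight that \<open>cond B C\<close> absorbs.\<close>

lemma cond_indep_iff_factorises:
  assumes J: "A \<subseteq> J" "B \<subseteq> J" "C \<subseteq> J" and disj: "A \<inter> B = {}" "A \<inter> C = {}" "B \<inter> C = {}"
  shows "cond_indep \<C> X n \<omega> A B C \<longleftrightarrow> (\<exists>p. factorises A B C p)"
    and "cond_indep \<C> X n \<omega> A B C \<Longrightarrow> factorises A B C (cond A C)"
proof -
  have U [simp]: "(A \<union> B) \<inter> C = {}"
    using disj by auto
  note [simp] = J disj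
  let ?h = "split_set \<C> X A B"
  have h [simp]: "det ?h" "?h \<in> Arr \<C>" "Dom \<C> ?h = TS (A \<union> B)" "Cod \<C> ?h = TS A \<odot> TS B"
    by (simp_all add: split_set_eq_pair)
  show "factorises A B C (cond A C)" if "cond_indep \<C> X n \<omega> A B C"
  proof -
    have hn: "?h \<cdot> cond (A \<union> B) C = \<langle>cond A C, cond B C\<rangle>"
      using that by (simp add: cond_indep_iff_pair)
    have "?h \<cdot> raw_cond (A \<union> B) C = \<langle>cond A C, cond B C\<rangle> \<star> density C C"
      by (simp add: raw_cond_eq_weight Comp_weight hn)
    also have "\<dots> = \<langle>cond A C, raw_cond B C\<rangle>"
      by (simp add: raw_cond_eq_weight pair_weight_right)
    finally show ?thesis
      by (simp add: factorises_iff partial_channel_cond)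
  qed
  moreover have "cond_indep \<C> X n \<omega> A B C" if "factorises A B C p" for p
  proof -
    have p: "partial_channel \<C> p" and [simp]: "Dom \<C> p = TS C" "Cod \<C> p = TS A"
      and hu: "?h \<cdot> raw_cond (A \<union> B) C = \<langle>p, raw_cond B C\<rangle>"
      using that by (simp_all add: factorises_iff)
    have [simp]: "p \<in> Arr \<C>"
      using p by (simp add: partial_channel_def)
    \<comment> \<open>Normalisation commutes with the total arrow \<open>?h\<close> and with
      pairing, and it fixes the partial channel \<open>p\<close>.\<close>
    have hn: "?h \<cdot> cond (A \<union> B) C = \<langle>p, cond B C\<rangle>"
      using arg_cong [OF hu, of "Norm \<C>"] p
      by (simp add: Norm_total_Comp Norm_pair N1 flip: cond_on_eq_Norm)
    \<comment> \<open>Marginalising the conditional on \<open>A \<union> B\<close> gives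
      \<open>cond A C\<close>; by \<open>hn\<close> this is \<open>p\<close> weighted by the mass of
      \<open>cond B C\<close>.\<close>
    have "cond A C = restr (A \<union> B) A \<cdot> cond (A \<union> B) C"
      by (simp add: cond_on_eq_Norm restr_raw_cond flip: Norm_total_Comp)
    also have "\<dots> = proj1 (TS A) (TS B) \<cdot> ?h \<cdot> cond (A \<union> B) C"
      by (subst Comp_cong_right [of "proj1 (TS A) (TS B)" ?h "restr (A \<union> B) A"])
        (simp_all add: split_set_eq_pair)
    also have "\<dots> = p \<star> (\<epsilon> (TS B) \<cdot> cond B C)"
      by (simp add: hn proj1_pair_weight)
    finally have "\<langle>cond A C, cond B C\<rangle> = \<langle>p, cond B C \<star> (\<epsilon> (TS B) \<cdot> cond B C)\<rangle>"
      by (simp add: pair_weight_left pair_weight_right)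
    also have "cond B C \<star> (\<epsilon> (TS B) \<cdot> cond B C) = cond B C"
      using partial_channel_cond [of B C] by (simp add: partial_channel_iff)
    finally show ?thesis
      using hn by (simp add: cond_indep_iff_pair)
  qed
  ultimately show "cond_indep \<C> X n \<omega> A B C \<longleftrightarrow> (\<exists>p. factorises A B C p)"
    by blast
qed

section \<open>The semi-graphoid axioms\<close>

lemma cond_indep_sym:
  assumes J: "A \<subseteq> J" "B \<subseteq> J" "C \<subseteq> J" and disj: "A \<inter> B = {}" "A \<inter> C = {}" "B \<inter> C = {}"
    and "cond_indep \<C> X n \<omega> A B C"
  shows "cond_indep \<C> X n \<omega> B A C"
proof -
  have [simp]: "(A \<union> B) \<inter> C = {}" "B \<inter> A = {}" "B \<union> A = A \<union> B"
    using disj by auto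
  note [simp] = J disj
  let ?h = "split_set \<C> X A B"
  have h: "?h \<in> Arr \<C>" "Dom \<C> ?h = TS (A \<union> B)" "Cod \<C> ?h = TS A \<odot> TS B"
    "split_set \<C> X B A = \<sigma> (TS A) (TS B) \<cdot> ?h"
    using split_set_eq_pair [of B A] by (simp_all add: split_set_eq_pair)
  have "?h \<cdot> cond (A \<union> B) C = \<langle>cond A C, cond B C\<rangle>"
    using assms by (simp add: cond_indep_iff_pair)
  then show ?thesis
    using h by (simp add: cond_indep_iff_pair)
qed

text \<open>Restricting the second output to \<open>B'\<close> in the unnormalised factorisation
  keeps the same \<open>p\<close>, because raw conditionals are compatible with restriction of
  outputs.\<close>

lemma cond_indep_decomposition:
  assumes J: "A \<subseteq> J" "B \<subseteq> J" "C \<subseteq> J" and disj: "A \<inter> B = {}" "A \<inter> C = {}" "B \<inter> C = {}"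
    and "B' \<subseteq> B" and indep: "cond_indep \<C> X n \<omega> A B C"
  shows "cond_indep \<C> X n \<omega> A B' C"
proof -
  have U [simp]: "B' \<subseteq> J" "A \<inter> B' = {}" "B' \<inter> C = {}" "A \<union> B' \<subseteq> A \<union> B" "(A \<union> B) \<inter> C = {}"
      "B' \<subseteq> A \<union> B"
    using J disj \<open>B' \<subseteq> B\<close> by auto
  note [simp] = J disj \<open>B' \<subseteq> B\<close>
  let ?p = "cond A C" and ?r = "\<i> (TS A) \<otimes> restr B B'"
  have "split_set \<C> X A B \<cdot> raw_cond (A \<union> B) C = \<langle>?p, raw_cond B C\<rangle>"
    using cond_indep_iff_factorises(2) [of A B C] indep factorises_iff [of A B C ?p] by simp
  then have eq: "?r \<cdot> split_set \<C> X A B \<cdot> raw_cond (A \<union> B) C = ?r \<cdot> \<langle>?p, raw_cond B C\<rangle>"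
    by simp
  have "?r \<cdot> split_set \<C> X A B = split_set \<C> X A B' \<cdot> restr (A \<union> B) (A \<union> B')"
    by (simp add: split_set_eq_pair)
  then have "?r \<cdot> split_set \<C> X A B \<cdot> raw_cond (A \<union> B) C
      = (split_set \<C> X A B' \<cdot> restr (A \<union> B) (A \<union> B')) \<cdot> raw_cond (A \<union> B) C"
    by (intro Comp_cong_right) (simp_all add: split_set_eq_pair)
  also have "\<dots> = split_set \<C> X A B' \<cdot> raw_cond (A \<union> B') C"
    by (subst Comp_assoc') (simp_all add: split_set_eq_pair restr_raw_cond)
  finally have "split_set \<C> X A B' \<cdot> raw_cond (A \<union> B') C = \<langle>?p, raw_cond B' C\<rangle>"
    using eq by (simp add: restr_raw_cond)
  then have "factorises A B' C ?p"
    by (simp add: factorises_iff partial_channel_cond)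
  then show ?thesis
    by (auto simp: cond_indep_iff_factorises(1))
qed

lemma cond_indep_weak_union:
  assumes J: "A \<subseteq> J" "B \<subseteq> J" "C \<subseteq> J" "D \<subseteq> J"
    and disj: "A \<inter> B = {}" "A \<inter> C = {}" "A \<inter> D = {}" "B \<inter> C = {}" "B \<inter> D = {}" "C \<inter> D = {}"
    and indep: "cond_indep \<C> X n \<omega> A (B \<union> D) C"
  shows "cond_indep \<C> X n \<omega> A B (C \<union> D)"
proof -
  note [simp] = J
  have [simp]: "A \<inter> (B \<union> D) = {}" "A \<inter> (C \<union> D) = {}" "B \<inter> (C \<union> D) = {}" "(B \<union> D) \<inter> C = {}" "A \<inter> C = {}"
      "A \<inter> B = {}"
    using disj by auto
  have sets: "A \<union> (B \<union> D) \<union> C = A \<union> B \<union> (C \<union> D)" "B \<union> D \<union> C = B \<union> (C \<union> D)"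
    by auto
  let ?p = "cond A C" and ?R = "A \<union> B \<union> (C \<union> D)"
  \<comment> \<open>The witness forgets \<open>D\<close> and applies the channel out of
    \<open>C\<close>. Read on \<open>?R\<close> it has the same graph as \<open>?p\<close>, so the
    same equation of densities serves.\<close>
  let ?q = "?p \<cdot> restr (C \<union> D) C"
  have "C \<subseteq> ?R" "C \<union> D \<subseteq> ?R"
    by auto
  then have "graph (C \<union> D) A ?q ?R = graph C A ?p ?R"
    by (simp add: graph_def)
  moreover have "factorises A (B \<union> D) C ?p"
    using indep by (intro cond_indep_iff_factorises(2)) simp_all
  ultimately have "factorises A B (C \<union> D) ?q"
    by (simp add: factorises_def sets partial_channel_Comp)
  then show ?thesis
    by (auto simp: cond_indep_iff_factorises(1))
qed

lemma cond_indep_contraction: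
  assumes J: "A \<subseteq> J" "B \<subseteq> J" "C \<subseteq> J" "D \<subseteq> J"
    and disj: "A \<inter> B = {}" "A \<inter> C = {}" "A \<inter> D = {}" "B \<inter> C = {}" "B \<inter> D = {}" "C \<inter> D = {}"
    and indep: "cond_indep \<C> X n \<omega> A B (C \<union> D)" "cond_indep \<C> X n \<omega> A D C"
  shows "cond_indep \<C> X n \<omega> A (B \<union> D) C"
proof -
  note [simp] = J
  have [simp]: "A \<inter> (B \<union> D) = {}" "A \<inter> (C \<union> D) = {}" "B \<inter> (C \<union> D) = {}" "(B \<union> D) \<inter> C = {}" "A \<inter> C = {}"
      "A \<inter> B = {}" "A \<inter> D = {}" "D \<inter> C = {}"
    using disj by auto
  let ?E = "C \<union> D" and ?R = "A \<union> B \<union> (C \<union> D)"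
  have sets: "A \<union> (B \<union> D) \<union> C = ?R" "B \<union> D \<union> C = B \<union> ?E" "A \<union> D \<union> C = A \<union> ?E" "D \<union> C = ?E"
    by auto
  have [simp]: "A \<subseteq> ?R" "B \<subseteq> ?R" "C \<subseteq> ?R" "?E \<subseteq> ?R" "A \<union> ?E \<subseteq> ?R" "B \<union> ?E \<subseteq> ?R" "?R \<subseteq> J"
      "C \<subseteq> A \<union> ?E" "?E \<subseteq> A \<union> ?E"
    by auto
  let ?p = "cond A C" and ?a = "cond A ?E" and ?b = "cond B ?E" and ?w = "density ?E ?R"
  have "factorises A B ?E ?a"
    using indep by (intro cond_indep_iff_factorises(2)) simp_all
  then have 1: "density ?R ?R = graph ?E A ?a ?R \<star> density (B \<union> ?E) ?R"
    by (simp add: factorises_def)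
  have "factorises A D C ?p"
    using indep by (intro cond_indep_iff_factorises(2)) simp_all
  then have "density (A \<union> ?E) (A \<union> ?E) = graph C A ?p (A \<union> ?E) \<star> density ?E (A \<union> ?E)"
    by (simp add: factorises_def sets)
  \<comment> \<open>The factorisation for \<open>A\<close> and \<open>D\<close> lives on the indices
    without \<open>B\<close>; restriction pulls it back to \<open>?R\<close>.\<close>
  then have "density (A \<union> ?E) (A \<union> ?E) \<cdot> restr ?R (A \<union> ?E)
      = (graph C A ?p (A \<union> ?E) \<star> density ?E (A \<union> ?E)) \<cdot> restr ?R (A \<union> ?E)"
    by simp
  then have 2: "density (A \<union> ?E) ?R = graph C A ?p ?R \<star> ?w"
    by (subst (asm) weight_Comp) auto
  have 3: "density (A \<union> ?E) ?R = graph ?E A ?a ?R \<star> ?w"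
    by (rule density_Un) simp_all
  have 4: "density (B \<union> ?E) ?R = graph ?E B ?b ?R \<star> ?w"
    by (rule density_Un) simp_all
  \<comment> \<open>\<open>1\<close> and \<open>4\<close> bring out the common factor
    \<open>?w\<close>; \<open>2\<close> and \<open>3\<close> then exchange the graph of
    \<open>?a\<close> for that of \<open>?p\<close> in the presence of that factor.\<close>
  have "density ?R ?R = (graph ?E A ?a ?R \<star> ?w) \<star> graph ?E B ?b ?R"
    unfolding 1 4 by (simp add: weight_assoc weight_right_comm)
  also have "\<dots> = (graph C A ?p ?R \<star> ?w) \<star> graph ?E B ?b ?R"
    using 2 3 by simp
  also have "\<dots> = graph C A ?p ?R \<star> density (B \<union> ?E) ?R"
    unfolding 4 by (simp add: weight_assoc weight_right_comm)
  finally have "factorises A (B \<union> D) C ?p"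
    by (simp add: factorises_def sets partial_channel_cond)
  then show ?thesis
    by (auto simp: cond_indep_iff_factorises(1))
qed

end

theorem theorem2p19:
  fixes \<C> :: "('o, 'm, 'z) ecc_scheme" and X :: "nat \<Rightarrow> 'o" and n :: nat and \<omega> :: 'm
    and A B C D :: "nat set"
  assumes "effect_conditioning \<C>"
    and "\<And>i. i \<in> {1..n} \<Longrightarrow> X i \<in> Obj \<C>"
    and "\<omega> \<in> hom \<C> (Unit \<C>) (tensor_set \<C> X {1..n})"
    and "A \<subseteq> {1..n}" "B \<subseteq> {1..n}" "C \<subseteq> {1..n}" "D \<subseteq> {1..n}"
    and "A \<inter> B = {}" "A \<inter> C = {}" "A \<inter> D = {}" "B \<inter> C = {}" "B \<inter> D = {}" "C \<inter> D = {}"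
  shows "(cond_indep \<C> X n \<omega> A B C \<longleftrightarrow> cond_indep \<C> X n \<omega> B A C)
    \<and> (cond_indep \<C> X n \<omega> A (B \<union> D) C \<longrightarrow>
         cond_indep \<C> X n \<omega> A B C \<and> cond_indep \<C> X n \<omega> A D C)
    \<and> (cond_indep \<C> X n \<omega> A (B \<union> D) C \<longrightarrow> cond_indep \<C> X n \<omega> A B (C \<union> D))
    \<and> (cond_indep \<C> X n \<omega> A B (C \<union> D) \<and> cond_indep \<C> X n \<omega> A D C \<longrightarrow>
         cond_indep \<C> X n \<omega> A (B \<union> D) C)"
proof -
  interpret effect_conditioning \<C> by fact
  interpret indexed_state \<C> X "{1..n}" n \<omega>
    using assms(2,3) by unfold_locales auto
  have BD: "B \<union> D \<subseteq> {1..n}" "A \<inter> (B \<union> D) = {}" "(B \<union> D) \<inter> C = {}"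
    using assms by auto
  show ?thesis
  proof (intro conjI impI iffI)
    show "cond_indep \<C> X n \<omega> B A C" if "cond_indep \<C> X n \<omega> A B C"
      using that assms by (intro cond_indep_sym [of A B C])
    show "cond_indep \<C> X n \<omega> A B C" if "cond_indep \<C> X n \<omega> B A C"
      using that assms by (intro cond_indep_sym [of B A C]) auto
    show "cond_indep \<C> X n \<omega> A B C" if "cond_indep \<C> X n \<omega> A (B \<union> D) C"
      using that assms BD by (intro cond_indep_decomposition [of A "B \<union> D" C B]) auto
    show "cond_indep \<C> X n \<omega> A D C" if "cond_indep \<C> X n \<omega> A (B \<union> D) C"
      using that assms BD by (intro cond_indep_decomposition [of A "B \<union> D" C D]) auto
    show "cond_indep \<C> X n \<omega> A B (C \<union> D)" if "cond_indep \<C> X n \<omega> A (B \<union> D) C"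
      using that assms by (intro cond_indep_weak_union [of A B C D])
    show "cond_indep \<C> X n \<omega> A (B \<union> D) C"
      if "cond_indep \<C> X n \<omega> A B (C \<union> D) \<and> cond_indep \<C> X n \<omega> A D C"
      using that assms by (intro cond_indep_contraction [of A B C D]) auto
  qed
qed

end
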